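(* Let $A:\mathcal{H}\to\mathcal{H}$ be Hermitian and let $\mathcal{X}$ and $\mathcal{Y}$ both be subspaces of $\mathcal{H}$ with $\dim\mathcal{X}=\dim\mathcal{Y}$. Then $$\left| \Lambda\left(P_{\mathcal{X}}A|_{\mathcal{X}}\right) - \Lambda\left(P_{\mathcal{Y}}A|_{\mathcal{Y}}\right) \right| \prec_w (\lambda_{\max}-\lambda_{\min})\,\sin\Theta(\mathcal{X},\mathcal{Y}),$$ where $\lambda_{\min}$ and $\lambda_{\max}$ are the smallest and largest eigenvalues of $A$, respectively.
   Context: $\mathcal{H}$ is a real or complex vector space of finite dimension $n$ equipped with an inner product. $P_{\mathcal{X}}$ denotes the orthogonal projector onto a subspace $\mathcal{X}$ of $\mathcal{H}$. For an operator $B:\mathcal{H}\to\mathcal{H}$, $s_1(B)\ge s_2(B)\ge\cdots$ are its singular values in nonincreasing order. For a Hermitian operator $B$, $\Lambda(B)$ is the vector of all eigenvalues of $B$, counted with multiplicity, in nonincreasing order. Ritz values: for Hermitian $A:\mathcal{H}\to\mathcal{H}$ and a subspace $\mathcal{X}$ (the trial subspace), $P_{\mathcal{X}}A|_{\mathcal{X}}:\mathcal{X}\to\mathcal{X}$ is the restriction of $P_{\mathcal{X}}A$ to its invariant subspace $\mathcal{X}$ (a Hermitian operator on $\mathcal{X}$); its eigenvalues $\Lambda(P_{\mathcal{X}}A|_{\mathcal{X}})$ are the Ritz values of $A$ with respect to $\mathcal{X}$. Principal angles: for subspaces $\mathcal{X},\mathcal{Y}$ of $\mathcal{H}$ let $m=\min\{\dim\mathcal{X},\dim\mathcal{Y}\}$.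 The vector of principal angles $\Theta(\mathcal{X},\mathcal{Y})=[\theta_1,\ldots,\theta_m]$, $\theta_i\in[0,\pi/2]$, in nondecreasing order, is defined by $\cos\Theta(\mathcal{X},\mathcal{Y})=[s_1(P_{\mathcal{X}}P_{\mathcal{Y}}),\ldots,s_m(P_{\mathcal{X}}P_{\mathcal{Y}})]$. The sine of $\Theta$, the absolute value $|\cdot|$ of a vector and differences of vectors are taken componentwise. Weak majorization: for a real vector $x=[x_1,\ldots,x_n]$, $x^\downarrow$ is the vector obtained by rearranging the entries of $x$ in nonincreasing order. For real vectors $x,y$ of length $n$, $x\prec_w y$ means $\sum_{i=1}^k x_i^\downarrow\le\sum_{i=1}^k y_i^\downarrow$ for all $k=1,\ldots,n$. Vectors of different lengths are compared by appending zeros to the shorter one to make the lengths equal. *)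

theory Defs
  imports Complex_Main "Jordan_Normal_Form.Conjugate"
begin

text \<open>
  The scalars are only ever instantiated with \<^typ>\<open>real\<close> (where \<^const>\<open>conjugate\<close> is the
  identity) and \<^typ>\<open>complex\<close> (where it is \<^const>\<open>cnj\<close>).
\<close>

locale finite_dim_inner_product_space = vector_space scale
  for scale :: "'k::{real_field, conjugatable_field} \<Rightarrow> 'v::ab_group_add \<Rightarrow> 'v" (infixr \<open>*s\<close> 75) +
  fixes ip :: "'v \<Rightarrow> 'v \<Rightarrow> 'k"
  assumes ip_add_left: "ip (x + y) z = ip x z + ip y z"
    and ip_scale_left: "ip (c *s x) y = c * ip x y"
    and ip_conjugate: "ip y x = conjugate (ip x y)"
    and ip_pos: "x \<noteq> 0 \<Longrightarrow> \<exists>r>0. ip x x = of_real r"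
    and finite_dim: "\<exists>B. finite B \<and> span B = UNIV"
begin

definition hermitian :: "('v \<Rightarrow> 'v) \<Rightarrow> bool" where
  "hermitian A \<longleftrightarrow> Vector_Spaces.linear scale scale A \<and> (\<forall>x y. ip (A x) y = ip x (A y))"

definition adjoint_op :: "('v \<Rightarrow> 'v) \<Rightarrow> 'v \<Rightarrow> 'v" where
  "adjoint_op B = (SOME C. \<forall>x y. ip (B x) y = ip x (C y))"

definition orth_projector :: "'v set \<Rightarrow> 'v \<Rightarrow> 'v" where
  "orth_projector X v = (THE p. p \<in> X \<and> (\<forall>x\<in>X. ip (v - p) x = 0))"

text \<open>
  An operator \<open>B : X \<rightarrow> X\<close> on a subspace \<open>X\<close> is represented by a function on the whole space of
  which only the values on \<open>X\<close> are used. The following notions are applied only to operators that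
  are Hermitian on \<open>X\<close>: all their eigenvalues are real, and algebraic and geometric multiplicities
  agree, so that counting with the dimension of the eigenspace is counting with multiplicity.
\<close>

definition eigenspace_on :: "'v set \<Rightarrow> ('v \<Rightarrow> 'v) \<Rightarrow> real \<Rightarrow> 'v set" where
  "eigenspace_on X B \<mu> = {v \<in> X. B v = of_real \<mu> *s v}"

definition eigenvalues_on :: "'v set \<Rightarrow> ('v \<Rightarrow> 'v) \<Rightarrow> real set" where
  "eigenvalues_on X B = {\<mu>. \<exists>v \<in> eigenspace_on X B \<mu>. v \<noteq> 0}"

definition Lambda_on :: "'v set \<Rightarrow> ('v \<Rightarrow> 'v) \<Rightarrow> real list" where
  "Lambda_on X B =
     concat (map (\<lambda>\<mu>. replicate (dim (eigenspace_on X B \<mu>)) \<mu>)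
                 (rev (sorted_list_of_set (eigenvalues_on X B))))"

definition ritz_values :: "('v \<Rightarrow> 'v) \<Rightarrow> 'v set \<Rightarrow> real list" where
  "ritz_values A X = Lambda_on X (orth_projector X \<circ> A)"

definition singular_values :: "('v \<Rightarrow> 'v) \<Rightarrow> real list" where
  "singular_values B = map sqrt (Lambda_on UNIV (adjoint_op B \<circ> B))"

definition principal_angles :: "'v set \<Rightarrow> 'v set \<Rightarrow> real list" where
  "principal_angles X Y =
     map arccos (take (min (dim X) (dim Y))
                      (singular_values (orth_projector X \<circ> orth_projector Y)))"

end

definition weakly_majorized :: "real list \<Rightarrow> real list \<Rightarrow> bool" (infix \<open>\<prec>\<^sub>w\<close> 50) where
  "xs \<prec>\<^sub>w ys \<longleftrightarrow>
     (let n = max (length xs) (length ys);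
          decreasing = (\<lambda>zs. rev (sort (zs @ replicate (n - length zs) 0)))
      in \<forall>k\<in>{1..n}. sum_list (take k (decreasing xs)) \<le> sum_list (take k (decreasing ys)))"

definition abs_diff :: "real list \<Rightarrow> real list \<Rightarrow> real list" where
  "abs_diff xs ys = map2 (\<lambda>x y. \<bar>x - y\<bar>) xs ys"

end

theory Submission
  imports Defs "HOL-Computational_Algebra.Fundamental_Theorem_Algebra"
begin

text \<open>
  After a shift, \<open>0 \<le> A \<le> c\<close> with \<open>c = \<lambda>\<^sub>m\<^sub>a\<^sub>x - \<lambda>\<^sub>m\<^sub>i\<^sub>n\<close>; write \<open>A = B\<^sup>2\<close> with \<open>B\<close> Hermitian, so that the Ritz values
  of \<open>A\<close> on \<open>X\<close> are the largest eigenvalues of \<open>B P\<^sub>X B\<close>. Let \<open>\<tau>\<close> be the \<open>k\<close>-th largest sine and let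
  \<open>E \<ge> 0\<close> be the part of \<open>P\<^sub>Y - P\<^sub>X\<close> above \<open>\<tau>\<close>, so that \<open>P\<^sub>Y \<le> P\<^sub>X + E + \<tau>\<close>. By Weyl monotonicity the
  eigenvalues of \<open>B (P\<^sub>X + E) B\<close> dominate the Ritz values on \<open>X\<close> as well as those on \<open>Y\<close> lowered by
  \<open>c \<tau>\<close>, and their sum exceeds the trace of \<open>B P\<^sub>X B\<close> only by \<open>tr (A E)\<close>. Hence the indices at
  which the Ritz value on \<open>Y\<close> is the larger one contribute at most \<open>c \<tau>\<close> each plus \<open>tr (A E)\<close>. The
  remaining indices are treated with \<open>c - A\<close> in place of \<open>A\<close>, which gives \<open>tr ((c - A) E)\<close>; the two
  traces add up to \<open>c tr E\<close>. Finally the positive eigenvalues of \<open>P\<^sub>Y - P\<^sub>X\<close> are bounded by the sines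
  of the principal angles, so that \<open>k \<tau> + tr E\<close> is at most the sum of the \<open>k\<close> largest sines.
\<close>

subsection \<open>Sorted lists and real polynomials\<close>

text \<open>\<open>Lambda_on\<close> has this shape once eigenspace dimensions are identified with
  counts, so it then returns the given eigenvalue list. Two nonincreasing lists with the same
  multiset are equal.\<close>

lemma concat_replicate_counts:
  fixes xs :: "'a::linorder list"
  assumes "sorted_wrt (\<ge>) xs"
  shows "concat (map (\<lambda>a. replicate (count (mset xs) a) a)
           (rev (sorted_list_of_set (set xs)))) = xs"
proof -
  let ?c = "\<lambda>ys. concat (map (\<lambda>a. replicate (count (mset xs) a) a) ys)"
  have r: "sorted_wrt (\<ge>) (replicate n a)" for n and a :: 'a
    by (induction n) auto
  have 1: "sorted_wrt (\<ge>) (?c ys)" if "sorted_wrt (\<ge>) ys" for ys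
    using that by (induction ys) (auto simp: sorted_wrt_append r)
  have 2: "count (mset (?c ys)) y = (if y \<in> set ys then count (mset xs) y else 0)"
    if "distinct ys" for ys y
    using that by (induction ys) auto
  let ?ys = "rev (sorted_list_of_set (set xs))"
  have "count (mset (?c ?ys)) y = count (mset xs) y" for y
    by (subst 2) (auto simp: count_eq_zero_iff)
  hence "mset (?c ?ys) = mset xs" by (rule multiset_eqI)
  moreover have "sorted_wrt (\<ge>) (?c ?ys)"
    by (rule 1) (simp add: sorted_wrt_rev)
  ultimately have "sort xs = rev (?c ?ys)"
    by (intro properties_for_sort) (simp_all only: sorted_wrt_rev mset_rev)
  moreover have "sort xs = rev xs"
    using assms by (intro properties_for_sort) (simp_all add: sorted_wrt_rev)
  ultimately have "rev (?c ?ys) = rev xs" by (rule trans[OF sym])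
  thus ?thesis by (rule rev_is_rev_conv[THEN iffD1])
qed

text \<open>The \<open>k\<close> largest entries of \<open>xs\<close> sit at some index set of size
  \<open>k\<close>, so bounding the sums over all index sets suffices and no ordering of
  \<open>xs\<close> is required. As \<open>zs\<close> is nondecreasing, its largest entries are read
  from the end.\<close>

lemma weakly_majorizedI:
  assumes len: "length xs = m" "length zs = m" and zs: "sorted zs"
    and le: "\<And>J. J \<subseteq> {..<m} \<Longrightarrow> J \<noteq> {} \<Longrightarrow> (\<Sum>i\<in>J. xs ! i) \<le> (\<Sum>j<card J. zs ! (m - Suc j))"
  shows "xs \<prec>\<^sub>w zs"
proof -
  \<comment> \<open>\<open>p\<close> lists the positions of \<open>xs\<close> by nonincreasing
    entry, so its first \<open>k\<close> positions form the index set to which the hypothesis is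
    applied.\<close>
  define p where "p = rev (sort_key (\<lambda>i. xs ! i) [0..<m])"
  have p: "distinct p" "set p = {..<m}" by (auto simp: p_def)
  hence lp: "length p = m" using distinct_card[of p] by simp
  have "mset (map ((!) xs) (rev p)) = mset xs"
    using len(1) arg_cong[OF map_nth[of xs], of mset] by (simp add: p_def)
  moreover have "sorted (map ((!) xs) (rev p))" unfolding p_def rev_rev_ident by (rule sorted_sort_key)
  ultimately have "sort xs = map ((!) xs) (rev p)" by (rule properties_for_sort)
  hence sx: "rev (sort xs) = map ((!) xs) p" by (simp only: rev_map rev_rev_ident)
  have "sum_list (take k (rev (sort xs))) \<le> sum_list (take k (rev (sort zs)))" if k: "k \<in> {1..m}" for k
  proof -
    define J where "J = set (take k p)"
    have J: "J \<subseteq> {..<m}" using set_take_subset[of k p] unfolding J_def p(2) .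
    have cJ: "card J = k" using p(1) lp k by (simp add: J_def distinct_card)
    hence "J \<noteq> {}" using k by auto
    have "sum_list (take k (rev (sort xs))) = (\<Sum>i\<in>J. xs ! i)"
      unfolding sx take_map J_def using p(1) by (simp add: sum_list_distinct_conv_sum_set)
    also have "\<dots> \<le> (\<Sum>j<k. zs ! (m - Suc j))" using le[OF J \<open>J \<noteq> {}\<close>] cJ by simp
    also have "\<dots> = sum_list (take k (rev (sort zs)))"
      unfolding sorted_sort_id[OF zs] sum_list_sum_nth atLeast0LessThan
      using k len by (intro sum.cong) (auto simp: rev_nth)
    finally show ?thesis .
  qed
  thus ?thesis using len by (simp add: weakly_majorized_def)
qed

text \<open>Take a complex root \<open>a + b i\<close>. For \<open>b = 0\<close> it yields a linear
  factor, otherwise the real polynomial with this root and its conjugate divides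
  \<open>p\<close>.\<close>

lemma real_poly_factor:
  fixes p :: "real poly"
  assumes "degree p > 0"
  shows "(\<exists>c. [:- c, 1:] dvd p) \<or> (\<exists>a b. b \<noteq> 0 \<and> [:a\<^sup>2 + b\<^sup>2, - 2 * a, 1:] dvd p)"
proof -
  let ?c = "map_poly complex_of_real"
  have add: "?c (p + q) = ?c p + ?c q" for p q
    by (intro poly_eqI) (simp add: coeff_map_poly)
  have smult: "?c (smult r q) = smult (of_real r) (?c q)" for r q
    by (intro poly_eqI) (simp add: coeff_map_poly)
  have mult: "?c (p * q) = ?c p * ?c q" for p q
    by (induction p) (simp_all add: add smult map_poly_pCons)
  have "degree (?c p) > 0" using assms by (simp add: degree_map_poly)
  hence "\<not> constant (poly (?c p))" by (simp add: constant_degree)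
  then obtain z where z: "poly (?c p) z = 0" using fundamental_theorem_of_algebra by blast
  define a b where "a = Re z" "b = Im z"
  show ?thesis
  proof (cases "b = 0")
    case True
    hence "z = of_real a" by (simp add: a_b_def complex_eq_iff)
    moreover have "poly (?c p) (of_real a) = of_real (poly p a)"
      by (induction p) (simp_all add: map_poly_pCons)
    ultimately have "poly p a = 0" using z by simp
    thus ?thesis by (auto simp: poly_eq_0_iff_dvd)
  next
    case False
    define q where "q = [:a\<^sup>2 + b\<^sup>2, - 2 * a, 1:]"
    have qz: "poly (?c q) z = 0"
      by (simp add: q_def map_poly_pCons a_b_def complex_eq_iff power2_eq_square algebra_simps)
    \<comment> \<open>The remainder modulo \<open>q\<close> is real, of degree at most 1, and
      vanishes at a nonreal point; imaginary and real part force both coefficients to be 0.\<close>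
    have "?c p = ?c q * ?c (p div q) + ?c (p mod q)"
      by (subst mult_div_mod_eq[of q p, symmetric], subst add, subst mult) (rule refl)
    hence "poly (?c (p mod q)) z = 0" using z qz by simp
    moreover have "degree (p mod q) < 2"
      using degree_mod_less[of q p] by (auto simp: q_def)
    hence "p mod q = [:coeff (p mod q) 0, coeff (p mod q) 1:]"
      by (intro poly_eqI) (auto simp: coeff_pCons coeff_eq_0 split: nat.split)
    then obtain r0 r1 where r: "p mod q = [:r0, r1:]" by blast
    ultimately have "r1 = 0" "r0 = 0" using False
      by (auto simp: map_poly_pCons a_b_def complex_eq_iff)
    hence "q dvd p" using r by (simp add: dvd_eq_mod_eq_0)
    thus ?thesis using False unfolding q_def by blast
  qed
qed

subsection \<open>Real and complex inner product spaces\<close>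

text \<open>
  The class constraints on the scalars provide neither a real part nor factors of polynomials. Both
  are added axiomatically, so that the real case (\<open>re\<close> is the identity) and the complex case
  (\<open>re\<close> is \<open>Re\<close>) are treated at once.
\<close>

locale rc_inner_product_space = finite_dim_inner_product_space scale ip
  for scale :: "'k::{real_field, conjugatable_field} \<Rightarrow> 'v::ab_group_add \<Rightarrow> 'v" (infixr \<open>*s\<close> 75)
    and ip :: "'v \<Rightarrow> 'v \<Rightarrow> 'k" +
  fixes re :: "'k \<Rightarrow> real"
  assumes re_add: "re (a + b) = re a + re b"
    and re_of_real_mult: "re (of_real r * a) = r * re a"
    and re_1: "re 1 = 1"
    and re_conjugate: "re (conjugate a) = re a"
    and conjugate_of_real: "conjugate (of_real r :: 'k) = of_real r"
    and self_conjugate: "conjugate a = a \<Longrightarrow> a = of_real (re a)"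
    and re_norm_nonneg: "re (a * conjugate a) \<ge> 0"
    and real_quadratic_factor: "degree (p :: 'k poly) > 0 \<Longrightarrow> (\<exists>c. [:- c, 1:] dvd p) \<or>
        (\<exists>a b. b \<noteq> 0 \<and> [:of_real (a\<^sup>2 + b\<^sup>2), of_real (- 2 * a), 1:] dvd p)"
begin

text \<open>The space comes only with some finite spanning set, whereas the locale
  \<open>finite_dimensional_vector_space\<close> takes a fixed basis as a parameter; a choice
  supplies it.\<close>

definition basis :: "'v set" where
  "basis = (SOME B. finite B \<and> independent B \<and> span B = UNIV)"

lemma basis: "finite basis \<and> independent basis \<and> span basis = UNIV"
proof -
  obtain B where B: "finite B" "span B = UNIV" using finite_dim by auto
  obtain B' where "B' \<subseteq> B" "independent B'" "span B' = span B"
    using maximal_independent_subset[of B] by (metis span_eq span_superset order_trans subset_antisym span_mono span_span)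
  thus ?thesis unfolding basis_def using B by (intro someI_ex[where P="\<lambda>B. finite B \<and> independent B \<and> span B = UNIV"]) (metis finite_subset)
qed

sublocale finite_dimensional_vector_space scale basis
  by unfold_locales (use basis in auto)

lemma re_of_real [simp]: "re (of_real r) = r"
  using re_of_real_mult[of r 1] re_1 by simp

lemma re_0 [simp]: "re 0 = 0"
  using re_of_real[of 0] by simp

lemma re_minus: "re (- a) = - re a"
  using re_add[of a "- a"] by simp

lemma re_diff: "re (a - b) = re a - re b"
  using re_add[of a "- b"] re_minus[of b] by simp

lemma re_sum: "re (sum f S) = (\<Sum>x\<in>S. re (f x))"
  by (induction S rule: infinite_finite_induct) (auto simp: re_add)

lemma ip_add_right: "ip x (y + z) = ip x y + ip x z"
  by (metis ip_add_left ip_conjugate conjugate_dist_add)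

lemma ip_scale_right: "ip x (c *s y) = conjugate c * ip x y"
  by (metis ip_scale_left ip_conjugate conjugate_dist_mul)

lemma ip_0_left [simp]: "ip 0 x = 0"
  using ip_scale_left[of 0 0 x] by simp

lemma ip_0_right [simp]: "ip x 0 = 0"
  using ip_scale_right[of x 0 0] by simp

lemma ip_minus_left: "ip (- x) y = - ip x y"
  using ip_add_left[of x "- x" y] by (simp add: eq_neg_iff_add_eq_0 add.commute)

lemma ip_minus_right: "ip x (- y) = - ip x y"
  using ip_add_right[of x y "- y"] by (simp add: eq_neg_iff_add_eq_0 add.commute)

lemma ip_diff_left: "ip (x - y) z = ip x z - ip y z"
  using ip_add_left[of x "- y" z] by (simp add: ip_minus_left)

lemma ip_diff_right: "ip x (y - z) = ip x y - ip x z"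
  using ip_add_right[of x y "- z"] by (simp add: ip_minus_right)

lemma ip_sum_left: "ip (sum f S) y = (\<Sum>x\<in>S. ip (f x) y)"
  by (induction S rule: infinite_finite_induct) (auto simp: ip_add_left)

lemma ip_sum_right: "ip y (sum f S) = (\<Sum>x\<in>S. ip y (f x))"
  by (induction S rule: infinite_finite_induct) (auto simp: ip_add_right)

lemma ip_eq_0_commute: "ip x y = 0 \<Longrightarrow> ip y x = 0"
  by (metis ip_conjugate conjugate_zero)

definition norm2 :: "'v \<Rightarrow> real" where
  "norm2 x = re (ip x x)"

lemma ip_self: "ip x x = of_real (norm2 x)"
  unfolding norm2_def using ip_pos[of x] by (cases "x = 0") auto

lemma norm2_pos: "x \<noteq> 0 \<Longrightarrow> norm2 x > 0"
  unfolding norm2_def using ip_pos[of x] by auto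

lemma norm2_0 [simp]: "norm2 0 = 0"
  by (simp add: norm2_def)

lemma norm2_nonneg [simp]: "norm2 x \<ge> 0"
  using norm2_pos[of x] by (cases "x = 0") auto

lemma norm2_eq_0_iff [simp]: "norm2 x = 0 \<longleftrightarrow> x = 0"
  using norm2_pos[of x] by (cases "x = 0") auto

lemma ip_eq_0_iff [simp]: "ip x x = 0 \<longleftrightarrow> x = 0"
  by (simp add: ip_self)

lemma ip_ext: "(\<And>y. ip x y = ip x' y) \<Longrightarrow> x = x'"
  using ip_eq_0_iff[of "x - x'"] by (simp add: ip_diff_left)

lemma ip_ext_right: "(\<And>y. ip y x = ip y x') \<Longrightarrow> x = x'"
  using ip_eq_0_iff[of "x - x'"] by (simp add: ip_diff_right)

abbreviation symmetric :: "('v \<Rightarrow> 'v) \<Rightarrow> bool" where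
  "symmetric T \<equiv> \<forall>x y. ip (T x) y = ip x (T y)"

lemma symmetric_add: "symmetric T \<Longrightarrow> T (x + y) = T x + T y"
  by (rule ip_ext) (simp add: ip_add_left)

lemma symmetric_scale: "symmetric T \<Longrightarrow> T (c *s x) = c *s T x"
  by (rule ip_ext) (simp add: ip_scale_left)

lemma symmetric_0: "symmetric T \<Longrightarrow> T 0 = 0"
  using symmetric_scale[of T 0 0] by simp

lemma hermitianD: "hermitian T \<Longrightarrow> symmetric T"
  by (simp add: hermitian_def)

subsection \<open>Existence of eigenvectors\<close>

text \<open>This is p(T) v by Horner's scheme. \<open>T\<close> is an arbitrary function here, so
  the recursion for \<open>pCons\<close> asks for \<open>T 0 = 0\<close>, to be consistent at the
  zero polynomial.\<close>

definition poly_op :: "('v \<Rightarrow> 'v) \<Rightarrow> 'k poly \<Rightarrow> 'v \<Rightarrow> 'v" where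
  "poly_op T p = fold_coeffs (\<lambda>a f v. a *s v + T (f v)) p (\<lambda>v. 0)"

lemma poly_op_0 [simp]: "poly_op T 0 v = 0"
  by (simp add: poly_op_def)

lemma poly_op_pCons:
  assumes "T 0 = 0"
  shows "poly_op T (pCons a p) v = a *s v + T (poly_op T p v)"
  by (cases "a = 0 \<and> p = 0") (auto simp: poly_op_def assms)

context
  fixes T :: "'v \<Rightarrow> 'v"
  assumes T_add: "\<And>x y. T (x + y) = T x + T y"
    and T_scale: "\<And>c x. T (c *s x) = c *s T x"
begin

lemma T_0: "T 0 = 0"
  using T_scale[of 0 0] by simp

lemma T_diff: "T (x - y) = T x - T y"
  using T_add[of "x - y" y] by simp

lemma poly_op_add: "poly_op T (p + q) v = poly_op T p v + poly_op T q v"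
  by (induction p q rule: poly_induct2) (auto simp: poly_op_pCons T_0 T_add scale_left_distrib)

lemma poly_op_smult: "poly_op T (smult c p) v = c *s poly_op T p v"
  by (induction p) (auto simp: poly_op_pCons T_0 T_scale scale_right_distrib)

lemma poly_op_mult: "poly_op T (p * q) v = poly_op T p (poly_op T q v)"
  by (induction p) (auto simp: poly_op_pCons T_0 poly_op_add poly_op_smult)

lemma poly_op_mem:
  assumes "subspace X" "\<And>x. x \<in> X \<Longrightarrow> T x \<in> X" "v \<in> X"
  shows "poly_op T p v \<in> X"
  by (induction p) (auto simp: poly_op_pCons T_0 assms intro!: subspace_add subspace_scale subspace_0)

lemma poly_op_monom: "poly_op T (monom 1 n) v = (T ^^ n) v"
  by (induction n) (auto simp: monom_Suc poly_op_pCons T_0 monom_0)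

text \<open>The iterates of \<open>v\<close> under \<open>T\<close> cannot stay independent in
  finite dimension, so some iterate is a combination of the earlier ones. Read as a polynomial
  identity, this gives a monic annihilator.\<close>

lemma annihilating_poly: "\<exists>p. p \<noteq> 0 \<and> poly_op T p v = 0"
proof -
  define S where "S d = (\<lambda>i. (T ^^ i) v) ` {..<d}" for d
  have "\<exists>d. (T ^^ d) v \<in> span (S d)"
  proof (rule ccontr)
    assume "\<not> ?thesis"
    hence n: "(T ^^ d) v \<notin> span (S d)" for d by blast
    have "independent (S d) \<and> card (S d) = d" for d
    proof (induction d)
      case (Suc d)
      have e: "S (Suc d) = insert ((T ^^ d) v) (S d)" by (simp add: S_def lessThan_Suc)
      have "(T ^^ d) v \<notin> S d" using n[of d] span_base by blast
      thus ?case using Suc n[of d] unfolding e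
        by (auto simp: independent_insert S_def)
    qed (auto simp: S_def independent_empty)
    from this[of "Suc dimension"] show False
      using independent_card_le_dim[of "S (Suc dimension)" UNIV]
      by (simp add: dimension_def)
  qed
  then obtain d where d: "(T ^^ d) v \<in> span (S d)" by blast
  \<comment> \<open>The disjunct \<open>q = 0\<close> covers \<open>d = 0\<close>, where no degree
    lies below \<open>d\<close>. In either case \<open>q\<close> cannot cancel the leading term of
    the monomial of degree \<open>d\<close>.\<close>
  have "\<exists>q. (q = 0 \<or> degree q < d) \<and> x = poly_op T q v" if "x \<in> span (S d)" for x
    using that
  proof (induction rule: span_induct_alt)
    case base
    show ?case by (rule exI[of _ 0]) auto
  next
    case (step c x y)
    then obtain i q where i: "i < d" "x = (T ^^ i) v" and q: "q = 0 \<or> degree q < d" "y = poly_op T q v"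
      by (auto simp: S_def)
    have "degree (smult c (monom 1 i) + q) < d"
      using i q by (intro degree_add_less) (auto intro: le_less_trans[OF degree_smult_le] simp: degree_monom_eq)
    thus ?case using i q
      by (intro exI[of _ "smult c (monom 1 i) + q"]) (auto simp: poly_op_add poly_op_smult poly_op_monom)
  qed
  with d obtain q where q: "q = 0 \<or> degree q < d" "(T ^^ d) v = poly_op T q v" by blast
  have "coeff (monom 1 d + smult (-1) q) d = 1"
    using q(1) by (auto simp: coeff_eq_0)
  hence "monom 1 d + smult (-1) q \<noteq> 0" by force
  moreover have "poly_op T (monom 1 d + smult (-1) q) v = 0"
    unfolding poly_op_add poly_op_smult poly_op_monom using q by simp
  ultimately show ?thesis by blast
qed

text \<open>Split an annihilator as \<open>q * r\<close> with \<open>q\<close> linear or real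
  quadratic, and put \<open>w = r(T) v\<close>. If \<open>w = 0\<close>, then \<open>r\<close> is an
  annihilator of smaller degree. Otherwise a linear \<open>q\<close> makes \<open>w\<close> an
  eigenvector, with real eigenvalue by symmetry, and a quadratic \<open>q\<close> would give T w - a
  w the squared norm - b^2 \<open>norm2 w\<close>, which is negative. Symmetry is demanded only on
  \<open>X\<close>, so that compressions to \<open>X\<close> are covered.\<close>

lemma exists_eigenvector:
  assumes X: "subspace X" "\<And>x. x \<in> X \<Longrightarrow> T x \<in> X" "v \<in> X" "v \<noteq> 0"
    and sym: "\<And>x y. x \<in> X \<Longrightarrow> y \<in> X \<Longrightarrow> ip (T x) y = ip x (T y)"
  shows "\<exists>e\<in>X. e \<noteq> 0 \<and> (\<exists>\<mu>. T e = of_real \<mu> *s e)"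
proof -
  obtain p where "p \<noteq> 0" "poly_op T p v = 0" using annihilating_poly by blast
  thus ?thesis
  proof (induction "degree p" arbitrary: p rule: less_induct)
    case less
    have "degree p > 0"
    proof (rule ccontr)
      assume "\<not> ?thesis"
      then obtain c where "p = [:c:]" by (auto elim: degree_eq_zeroE)
      with less.prems X show False by (auto simp: poly_op_pCons T_0)
    qed
    then obtain q where q: "q dvd p" "degree q > 0"
      "(\<exists>c. q = [:- c, 1:]) \<or> (\<exists>a b. b \<noteq> 0 \<and> q = [:of_real (a\<^sup>2 + b\<^sup>2), of_real (- 2 * a), 1:])"
      using real_quadratic_factor[of p] by fastforce
    then obtain r where r: "p = q * r" by auto
    define w where "w = poly_op T r v"
    have wX: "w \<in> X" unfolding w_def by (intro poly_op_mem X) auto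
    have qw: "poly_op T q w = 0" using less.prems r by (simp add: w_def poly_op_mult)
    have r0: "r \<noteq> 0" using less.prems r by auto
    have dr: "degree r < degree p" using less.prems r q by (auto simp: degree_mult_eq)
    show ?case
    proof (cases "w = 0")
      case True
      with less.hyps[OF dr r0] show ?thesis by (simp add: w_def)
    next
      case w0: False
      from q(3) show ?thesis
      proof
        assume "\<exists>c. q = [:- c, 1:]"
        then obtain c where "q = [:- c, 1:]" by blast
        with qw have Tw: "T w = c *s w" by (simp add: poly_op_pCons T_0)
        have "c * ip w w = conjugate c * ip w w"
          using sym[OF wX wX] by (simp add: Tw ip_scale_left ip_scale_right)
        hence "conjugate c = c" using w0 by simp
        from self_conjugate[OF this] Tw wX w0 show ?thesis by metis
      next
        assume "\<exists>a b. b \<noteq> 0 \<and> q = [:of_real (a\<^sup>2 + b\<^sup>2), of_real (- 2 * a), 1:]"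
        then obtain a b where b: "b \<noteq> 0" "q = [:of_real (a\<^sup>2 + b\<^sup>2), of_real (- 2 * a), 1:]" by blast
        define u where "u = T w - of_real a *s w"
        have TwX: "T w \<in> X" using X wX by auto
        have "T (T w) = of_real (2 * a) *s T w - of_real (a\<^sup>2 + b\<^sup>2) *s w"
          using qw T_diff[of "T w" "(of_real a * 2) *s w"] T_scale unfolding b
          by (simp add: poly_op_pCons T_0 T_add T_scale algebra_simps)
        hence "ip (T (T w)) w = of_real (2 * a) * ip (T w) w - of_real (a\<^sup>2 + b\<^sup>2) * ip w w"
          by (simp add: ip_diff_left ip_scale_left)
        moreover have "ip (T (T w)) w = ip (T w) (T w)" using sym[OF TwX wX] .
        moreover have "ip w (T w) = ip (T w) w" using sym[OF wX wX] by simp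
        ultimately have "ip u u = - of_real (b\<^sup>2) * ip w w"
          unfolding u_def
          by (simp add: ip_diff_left ip_diff_right ip_scale_left ip_scale_right conjugate_of_real
              algebra_simps power2_eq_square)
        hence "ip u u = of_real (- (b\<^sup>2) * norm2 w)" by (simp add: ip_self)
        hence "norm2 u = - (b\<^sup>2) * norm2 w" unfolding norm2_def[of u] by (metis re_of_real)
        moreover have "b\<^sup>2 * norm2 w > 0" using b w0 norm2_pos by simp
        ultimately show ?thesis using norm2_nonneg[of u] by linarith
      qed
    qed
  qed
qed

end

section \<open>Linear maps and squared moduli of scalars\<close>

abbreviation lin :: "('v \<Rightarrow> 'v) \<Rightarrow> bool" where
  "lin T \<equiv> (\<forall>x y. T (x + y) = T x + T y) \<and> (\<forall>c x. T (c *s x) = c *s T x)"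

lemma lin_0: "lin T \<Longrightarrow> T 0 = 0"
  by (metis scale_zero_left)

lemma lin_sum: "lin T \<Longrightarrow> T (sum f S) = (\<Sum>x\<in>S. T (f x))"
  by (induction S rule: infinite_finite_induct) (auto simp: lin_0)

lemma symmetric_diff: "symmetric T \<Longrightarrow> T (x - y) = T x - T y"
  by (rule ip_ext) (simp add: ip_diff_left)

lemma symmetric_lin: "symmetric T \<Longrightarrow> lin T"
  by (metis symmetric_add symmetric_scale)

definition abs2 :: "'k \<Rightarrow> real" where
  "abs2 a = re (a * conjugate a)"

lemma abs2_nonneg [simp]: "abs2 a \<ge> 0"
  by (simp add: abs2_def re_norm_nonneg)

lemma abs2_0 [simp]: "abs2 0 = 0"
  by (simp add: abs2_def)

lemma abs2_conjugate [simp]: "abs2 (conjugate a) = abs2 a"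
  by (simp add: abs2_def mult.commute)

lemma abs2_ip_commute: "abs2 (ip x y) = abs2 (ip y x)"
  by (metis ip_conjugate abs2_conjugate)

subsection \<open>Orthonormal bases of subspaces\<close>

definition orthonormal :: "'v set \<Rightarrow> bool" where
  "orthonormal U \<longleftrightarrow> finite U \<and> (\<forall>u\<in>U. \<forall>w\<in>U. ip u w = (if u = w then 1 else 0))"

definition onb :: "'v set \<Rightarrow> 'v set \<Rightarrow> bool" where
  "onb X U \<longleftrightarrow> orthonormal U \<and> span U = X"

lemma orthonormal_subset: "orthonormal U \<Longrightarrow> V \<subseteq> U \<Longrightarrow> orthonormal V"
  unfolding orthonormal_def by (meson finite_subset subset_eq)

lemma ip_sum_orthonormal:
  assumes "orthonormal U" "w \<in> U"
  shows "ip (\<Sum>u\<in>U. f u *s u) w = f w"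
proof -
  have "ip (\<Sum>u\<in>U. f u *s u) w = (\<Sum>u\<in>U. if u = w then f u else 0)"
    using assms unfolding ip_sum_left orthonormal_def by (intro sum.cong) (auto simp: ip_scale_left)
  thus ?thesis using assms by (simp add: orthonormal_def)
qed

lemma ip_sum_sum_orthonormal:
  assumes "orthonormal U"
  shows "ip (\<Sum>u\<in>U. f u *s u) (\<Sum>u\<in>U. g u *s u) = (\<Sum>u\<in>U. f u * conjugate (g u))"
  unfolding ip_sum_right[of _ "\<lambda>u. g u *s u"]
  by (intro sum.cong) (auto simp: ip_scale_right ip_sum_orthonormal[OF assms])

lemma norm2_sum_orthonormal:
  assumes "orthonormal U"
  shows "norm2 (\<Sum>u\<in>U. f u *s u) = (\<Sum>u\<in>U. abs2 (f u))"
  by (simp add: norm2_def ip_sum_sum_orthonormal[OF assms] re_sum abs2_def)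

lemma orthonormal_independent:
  assumes "orthonormal U" shows "independent U"
proof -
  have "finite U" using assms by (simp add: orthonormal_def)
  thus ?thesis
  proof (rule independent_if_scalars_zero)
    fix f x assume "(\<Sum>x\<in>U. f x *s x) = 0" "x \<in> U"
    thus "f x = 0" using ip_sum_orthonormal[OF assms, of x f] by simp
  qed
qed

lemma dim_span_orthonormal: "orthonormal U \<Longrightarrow> dim (span U) = card U"
  by (simp add: dim_eq_card_independent orthonormal_independent)

lemma span_combination: "(\<Sum>u\<in>U. f u *s u) \<in> span U"
  by (intro span_sum span_scale span_base)

lemma ip_span_eq_0:
  assumes "x \<in> span U" "\<And>u. u \<in> U \<Longrightarrow> ip r u = 0"
  shows "ip r x = 0"
  using assms(1) by (induction rule: span_induct_alt) (auto simp: ip_add_right ip_scale_right assms(2))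

text \<open>The residual lies in the span of \<open>U\<close> and is orthogonal to \<open>U\<close>,
  hence orthogonal to itself.\<close>

lemma onb_expand:
  assumes "onb X U" "x \<in> X"
  shows "x = (\<Sum>u\<in>U. ip x u *s u)"
proof -
  let ?p = "\<Sum>u\<in>U. ip x u *s u"
  have o: "orthonormal U" and X: "X = span U" using assms by (auto simp: onb_def)
  have "?p \<in> span U" by (rule span_combination)
  hence r: "x - ?p \<in> span U" using assms X by (auto intro: span_diff)
  have "ip (x - ?p) (x - ?p) = 0"
    by (rule ip_span_eq_0[OF r]) (simp add: ip_diff_left ip_sum_orthonormal[OF o])
  thus ?thesis by simp
qed

lemma onb_norm2: "onb X U \<Longrightarrow> x \<in> X \<Longrightarrow> norm2 x = (\<Sum>u\<in>U. abs2 (ip x u))"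
  by (metis onb_expand norm2_sum_orthonormal onb_def)

text \<open>The sum meets the defining property of the projection. Uniqueness holds because two
  candidates differ by a vector of \<open>X\<close> that is orthogonal to \<open>X\<close>.\<close>

lemma orth_projector_eq:
  assumes "onb X U"
  shows "orth_projector X v = (\<Sum>u\<in>U. ip v u *s u)"
proof -
  let ?p = "\<Sum>u\<in>U. ip v u *s u"
  have o: "orthonormal U" and X: "X = span U" using assms by (auto simp: onb_def)
  have p: "?p \<in> X" unfolding X by (rule span_combination)
  have q: "ip (v - ?p) x = 0" if "x \<in> X" for x
    using that unfolding X by (rule ip_span_eq_0) (simp add: ip_diff_left ip_sum_orthonormal[OF o])
  show ?thesis unfolding orth_projector_def
  proof (rule the_equality)
    fix p' assume p': "p' \<in> X \<and> (\<forall>x\<in>X. ip (v - p') x = 0)"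
    have d: "p' - ?p \<in> X" using p p' unfolding X by (auto intro: span_diff)
    have "ip (p' - ?p) (p' - ?p) = ip (v - ?p) (p' - ?p) - ip (v - p') (p' - ?p)"
      by (simp only: ip_diff_left[symmetric]) (simp add: algebra_simps)
    also have "\<dots> = 0" using p' q d by simp
    finally show "p' = ?p" by simp
  qed (use p q in auto)
qed

subsection \<open>The spectral theorem\<close>

text \<open>Induction on the dimension: split off a unit eigenvector \<open>e\<close>. Its
  orthogonal complement within \<open>X\<close> is invariant, since symmetry moves \<open>T\<close>
  onto \<open>e\<close>, where it acts as a real scalar.\<close>

lemma exists_eigen_onb:
  assumes "subspace X" "lin T" "\<And>x. x \<in> X \<Longrightarrow> T x \<in> X"
    "\<And>x y. x \<in> X \<Longrightarrow> y \<in> X \<Longrightarrow> ip (T x) y = ip x (T y)"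
  shows "\<exists>U. onb X U \<and> (\<forall>u\<in>U. \<exists>\<mu>. T u = of_real \<mu> *s u)"
  using assms
proof (induction "dim X" arbitrary: X rule: less_induct)
  case less
  show ?case
  proof (cases "X \<subseteq> {0}")
    case True
    hence "X = {0}" using subspace_0[OF less.prems(1)] by auto
    thus ?thesis by (intro exI[of _ "{}"]) (auto simp: onb_def orthonormal_def)
  next
    case False
    then obtain v where v: "v \<in> X" "v \<noteq> 0" by auto
    obtain e0 \<mu> where e0: "e0 \<in> X" "e0 \<noteq> 0" "T e0 = of_real \<mu> *s e0"
      using exists_eigenvector[of T X v] less.prems v by blast
    define e where "e = of_real (1 / sqrt (norm2 e0)) *s e0"
    have eX: "e \<in> X" using e0 less.prems by (auto simp: e_def intro: subspace_scale)
    have Te: "T e = of_real \<mu> *s e"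
      using e0 less.prems(2) by (simp add: e_def mult.commute)
    have "ip e e = of_real (1 / sqrt (norm2 e0) * (1 / sqrt (norm2 e0)) * norm2 e0)"
      unfolding e_def ip_scale_left ip_scale_right conjugate_of_real ip_self[of e0]
      by (simp only: of_real_mult mult.assoc)
    also have "1 / sqrt (norm2 e0) * (1 / sqrt (norm2 e0)) * norm2 e0 = 1"
      using norm2_pos[OF e0(2)] by (simp del: norm2_eq_0_iff)
    finally have ee: "ip e e = 1" by simp
    define X' where "X' = {x \<in> X. ip x e = 0}"
    have sub: "subspace X'"
      using less.prems(1) unfolding subspace_def X'_def by (auto simp: ip_add_left ip_scale_left)
    have X'X: "X' \<subset> X" using eX ee unfolding X'_def by force
    have "span X' \<subset> span X"
      using X'X sub less.prems(1) by (simp add: span_eq_iff[THEN iffD2])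
    hence d: "dim X' < dim X" by (rule dim_psubset)
    have "ip (T x) e = 0" if "x \<in> X'" for x
      using less.prems(4)[of x e] that eX by (simp add: X'_def Te ip_scale_right)
    hence "\<And>x. x \<in> X' \<Longrightarrow> T x \<in> X'" using less.prems(3) by (auto simp: X'_def)
    moreover have "\<And>x y. x \<in> X' \<Longrightarrow> y \<in> X' \<Longrightarrow> ip (T x) y = ip x (T y)"
      using less.prems(4) by (auto simp: X'_def)
    ultimately obtain U where U: "onb X' U" "\<forall>u\<in>U. \<exists>\<mu>. T u = of_real \<mu> *s u"
      using less.hyps[OF d sub less.prems(2)] by blast
    have UX': "U \<subseteq> X'" using U(1) span_superset unfolding onb_def by blast
    hence "\<And>u. u \<in> U \<Longrightarrow> ip u e = 0 \<and> ip e u = 0"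
      by (auto simp: X'_def intro: ip_eq_0_commute)
    hence "orthonormal (insert e U)"
      using U(1) ee unfolding onb_def orthonormal_def by auto
    moreover have "span (insert e U) = X"
    proof
      show "span (insert e U) \<subseteq> X"
        using UX' eX less.prems(1) X'X by (intro span_minimal) auto
      show "X \<subseteq> span (insert e U)"
      proof
        fix x assume x: "x \<in> X"
        have "x - ip x e *s e \<in> X'"
          using x eX less.prems(1) ee
          by (auto simp: X'_def ip_diff_left ip_scale_left intro!: subspace_diff subspace_scale)
        hence "x - ip x e *s e \<in> span U" using U(1) by (simp add: onb_def)
        thus "x \<in> span (insert e U)" unfolding span_insert by blast
      qed
    qed
    ultimately show ?thesis
      using U(2) Te by (intro exI[of _ "insert e U"]) (auto simp: onb_def)
  qed
qed

text \<open>Eigenvalues are attached to the basis vectors by a function, so that the single list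
  \<open>us\<close> fixes the basis, the multiplicities and the nonincreasing order
  together.\<close>

definition eigenbasis :: "'v set \<Rightarrow> ('v \<Rightarrow> 'v) \<Rightarrow> 'v list \<Rightarrow> ('v \<Rightarrow> real) \<Rightarrow> bool" where
  "eigenbasis X T us \<mu> \<longleftrightarrow> distinct us \<and> onb X (set us) \<and>
     (\<forall>u\<in>set us. T u = of_real (\<mu> u) *s u) \<and> sorted_wrt (\<ge>) (map \<mu> us)"

lemma exists_eigenbasis:
  assumes "subspace X" "lin T" "\<And>x. x \<in> X \<Longrightarrow> T x \<in> X"
    "\<And>x y. x \<in> X \<Longrightarrow> y \<in> X \<Longrightarrow> ip (T x) y = ip x (T y)"
  obtains us \<mu> where "eigenbasis X T us \<mu>"
proof -
  obtain U where U: "onb X U" "\<forall>u\<in>U. \<exists>\<mu>. T u = of_real \<mu> *s u"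
    using exists_eigen_onb[OF assms] by blast
  then obtain \<mu> where \<mu>: "\<forall>u\<in>U. T u = of_real (\<mu> u) *s u" by metis
  obtain us where us: "set us = U" "distinct us"
    using U(1) finite_distinct_list[of U] by (auto simp: onb_def orthonormal_def)
  let ?us = "rev (sort_key \<mu> us)"
  have "sorted_wrt (\<ge>) (map \<mu> ?us)"
    using sorted_sort_key[of \<mu> us] by (simp only: rev_map[symmetric] sorted_wrt_rev)
  hence "eigenbasis X T ?us \<mu>" using U(1) \<mu> us by (simp add: eigenbasis_def)
  thus ?thesis by (rule that)
qed

lemma exists_onb: "subspace X \<Longrightarrow> \<exists>U. onb X U"
  using exists_eigen_onb[of X "\<lambda>x. x"] by auto

lemma eigenbasisD:
  assumes "eigenbasis X T us \<mu>"
  shows "distinct us" "onb X (set us)" "orthonormal (set us)" "span (set us) = X"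
    "\<And>u. u \<in> set us \<Longrightarrow> T u = of_real (\<mu> u) *s u"
    "\<And>i j. i \<le> j \<Longrightarrow> j < length us \<Longrightarrow> \<mu> (us ! j) \<le> \<mu> (us ! i)"
  using assms unfolding eigenbasis_def onb_def
  by (auto simp: sorted_wrt_iff_nth_less order_le_less)

lemma eigenbasis_length: "eigenbasis X T us \<mu> \<Longrightarrow> length us = dim X"
  using dim_span_orthonormal[of "set us"] by (simp add: eigenbasis_def onb_def distinct_card)

lemma eigen_expand:
  assumes "lin T" "\<And>u. u \<in> U \<Longrightarrow> T u = of_real (\<mu> u) *s u"
  shows "T (\<Sum>u\<in>U. f u *s u) = (\<Sum>u\<in>U. (of_real (\<mu> u) * f u) *s u)"
  using assms by (simp add: lin_sum mult.commute)

text \<open>Each eigenspace is spanned by the basis vectors carrying its eigenvalue, so its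
  dimension is the number of occurrences of that eigenvalue in \<open>map \<mu> us\<close>. From
  here on, \<open>Lambda_on\<close> is accessible through any eigenbasis.\<close>

lemma Lambda_on_eq:
  assumes E: "eigenbasis X T us \<mu>" and T: "lin T"
  shows "Lambda_on X T = map \<mu> us" "eigenvalues_on X T = \<mu> ` set us"
proof -
  note E' = eigenbasisD[OF E]
  have es: "eigenspace_on X T a = span {u \<in> set us. \<mu> u = a}" for a
  proof
    show "span {u \<in> set us. \<mu> u = a} \<subseteq> eigenspace_on X T a"
    proof (rule span_minimal)
      show "{u \<in> set us. \<mu> u = a} \<subseteq> eigenspace_on X T a"
        using E' span_base by (auto simp: eigenspace_on_def)
      show "subspace (eigenspace_on X T a)"
        using T lin_0[OF T] E'(4) subspace_span[of "set us"]
        by (auto simp: subspace_def eigenspace_on_def scale_right_distrib scale_left_commute)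
    qed
    show "eigenspace_on X T a \<subseteq> span {u \<in> set us. \<mu> u = a}"
    proof
      fix x assume "x \<in> eigenspace_on X T a"
      hence x: "x \<in> X" "T x = of_real a *s x" by (auto simp: eigenspace_on_def)
      \<comment> \<open>Comparing the coordinates of \<open>T x\<close> along \<open>u\<close> gives
        \<open>a * ip x u = \<mu> u * ip x u\<close>.\<close>
      have "ip x u = 0" if u: "u \<in> set us" "\<mu> u \<noteq> a" for u
      proof -
        have "ip (T x) u = of_real (\<mu> u) * ip x u"
          by (subst onb_expand[OF E'(2) x(1)])
            (simp add: eigen_expand[OF T E'(5)] ip_sum_orthonormal[OF E'(3) u(1)])
        hence "of_real a * ip x u = of_real (\<mu> u) * ip x u" by (simp only: x(2) ip_scale_left)
        thus ?thesis using u(2) by (simp add: eq_commute[of a])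
      qed
      hence "x = (\<Sum>u\<in>{u \<in> set us. \<mu> u = a}. ip x u *s u)"
        by (subst onb_expand[OF E'(2) x(1)], intro sum.mono_neutral_right) auto
      thus "x \<in> span {u \<in> set us. \<mu> u = a}"
        by (metis (no_types, lifting) span_sum span_scale span_base)
    qed
  qed
  have o: "orthonormal {u \<in> set us. \<mu> u = a}" for a
    by (rule orthonormal_subset[OF E'(3)]) auto
  have dimes: "dim (eigenspace_on X T a) = count (mset (map \<mu> us)) a" for a
    unfolding es dim_span_orthonormal[OF o] count_mset
    using E'(1) distinct_card[of "filter ((=) a \<circ> \<mu>) us"]
    by (simp add: count_list_eq_length_filter filter_map eq_commute[of _ a])
  show ev: "eigenvalues_on X T = \<mu> ` set us"
  proof -
    have "a \<in> eigenvalues_on X T \<longleftrightarrow> dim (eigenspace_on X T a) \<noteq> 0" for a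
      unfolding eigenvalues_on_def dim_eq_0 by auto
    thus ?thesis unfolding dimes by (auto simp: count_eq_zero_iff)
  qed
  show "Lambda_on X T = map \<mu> us"
    unfolding Lambda_on_def ev dimes
    using concat_replicate_counts[of "map \<mu> us"] E by (simp add: eigenbasis_def)
qed

subsection \<open>Orthogonal projectors\<close>

context
  fixes X assumes X: "subspace X"
begin

lemma orth_projector_mem [simp]: "orth_projector X v \<in> X"
proof -
  obtain U where U: "onb X U" using exists_onb[OF X] by blast
  hence "X = span U" by (simp add: onb_def)
  thus ?thesis unfolding orth_projector_eq[OF U] using span_combination by metis
qed

lemma ip_orth_projector_left: "x \<in> X \<Longrightarrow> ip (orth_projector X v) x = ip v x"
proof -
  assume x: "x \<in> X"
  obtain U where U: "onb X U" using exists_onb[OF X] by blast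
  have "ip (v - orth_projector X v) x = 0"
    by (rule ip_span_eq_0[of _ U])
      (use U x in \<open>auto simp: onb_def ip_diff_left ip_sum_orthonormal orth_projector_eq[OF U]\<close>)
  thus ?thesis by (simp add: ip_diff_left)
qed

lemma ip_orth_projector_right: "x \<in> X \<Longrightarrow> ip x (orth_projector X v) = ip x v"
  by (metis ip_orth_projector_left ip_conjugate)

lemma orth_projector_symmetric: "symmetric (orth_projector X)"
  using ip_orth_projector_left ip_orth_projector_right orth_projector_mem by metis

lemma orth_projector_id: "x \<in> X \<Longrightarrow> orth_projector X x = x"
proof -
  assume x: "x \<in> X"
  obtain U where U: "onb X U" using exists_onb[OF X] by blast
  show ?thesis using onb_expand[OF U x] by (simp add: orth_projector_eq[OF U])
qed

lemma re_ip_orth_projector: "re (ip (orth_projector X v) v) = norm2 (orth_projector X v)"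
  unfolding norm2_def using ip_orth_projector_right[of "orth_projector X v" v] by simp

lemma norm2_orth_projector_split:
  "norm2 v = norm2 (orth_projector X v) + norm2 (v - orth_projector X v)"
proof -
  have "norm2 (v - orth_projector X v) = re (ip v v) - re (ip v (orth_projector X v))
     - re (ip (orth_projector X v) v) + norm2 (orth_projector X v)"
    by (simp add: norm2_def ip_diff_left ip_diff_right re_diff)
  moreover have "re (ip v (orth_projector X v)) = re (ip (orth_projector X v) v)"
    by (metis re_conjugate ip_conjugate)
  ultimately show ?thesis by (simp add: re_ip_orth_projector norm2_def)
qed

lemma norm2_orth_projector_le: "norm2 (orth_projector X v) \<le> norm2 v"
  using norm2_orth_projector_split[of v] norm2_nonneg[of "v - orth_projector X v"] by linarith

end

section \<open>Dimension counting, quadratic forms on eigenbases, and square roots\<close>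

lemma exists_orthogonal_vector:
  assumes "subspace S" "length zs < dim S"
  shows "\<exists>w\<in>S. w \<noteq> 0 \<and> (\<forall>z\<in>set zs. ip w z = 0)"
  using assms
proof (induction zs arbitrary: S)
  case Nil
  hence "\<not> S \<subseteq> {0}" using dim_eq_0[of S] by linarith
  thus ?case by auto
next
  case (Cons z zs)
  define S' where "S' = {w \<in> S. ip w z = 0}"
  have sub: "subspace S'"
    using Cons.prems(1) unfolding subspace_def S'_def by (auto simp: ip_add_left ip_scale_left)
  \<comment> \<open>One more orthogonality condition costs at most one dimension: if some
    \<open>r\<close> in \<open>S\<close> violates it, each vector of \<open>S\<close> is a multiple
    of \<open>r\<close> plus a vector of \<open>S'\<close>.\<close>
  have "dim S \<le> Suc (dim S')"
  proof (cases "S' = S")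
    case False
    then obtain r where r: "r \<in> S" "ip r z \<noteq> 0" by (auto simp: S'_def)
    have "S \<subseteq> span (insert r S')"
    proof
      fix w assume w: "w \<in> S"
      have "w - (ip w z / ip r z) *s r \<in> S'"
        using w r Cons.prems(1)
        by (auto simp: S'_def ip_diff_left ip_scale_left intro!: subspace_diff subspace_scale)
      hence "w - (ip w z / ip r z) *s r \<in> span S'" by (rule span_base)
      thus "w \<in> span (insert r S')" unfolding span_insert by blast
    qed
    from dim_mono[OF this] show ?thesis by (simp add: dim_insert split: if_splits)
  qed simp
  hence "length zs < dim S'" using Cons.prems(2) by simp
  from Cons.IH[OF sub this] show ?case by (auto simp: S'_def)
qed

lemma eigen_form:
  assumes "orthonormal U" "x \<in> span U" "lin T" "\<And>u. u \<in> U \<Longrightarrow> T u = of_real (\<mu> u) *s u"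
  shows "re (ip (T x) x) = (\<Sum>u\<in>U. \<mu> u * abs2 (ip x u))"
    and "norm2 (T x) = (\<Sum>u\<in>U. (\<mu> u)\<^sup>2 * abs2 (ip x u))"
proof -
  have o: "onb (span U) U" using assms by (simp add: onb_def)
  have x: "x = (\<Sum>u\<in>U. ip x u *s u)" by (rule onb_expand[OF o assms(2)])
  have Tx: "T x = (\<Sum>u\<in>U. (of_real (\<mu> u) * ip x u) *s u)"
    by (subst x) (rule eigen_expand[OF assms(3,4)])
  have "ip (T x) x = ip (T x) (\<Sum>u\<in>U. ip x u *s u)" by (simp flip: x)
  also have "\<dots> = (\<Sum>u\<in>U. of_real (\<mu> u) * (ip x u * conjugate (ip x u)))"
    unfolding Tx ip_sum_sum_orthonormal[OF assms(1)] by (simp add: mult.assoc)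
  finally show "re (ip (T x) x) = (\<Sum>u\<in>U. \<mu> u * abs2 (ip x u))"
    by (simp add: re_sum re_of_real_mult abs2_def)
  have "abs2 (of_real r * a) = r\<^sup>2 * abs2 a" for r a
    unfolding abs2_def conjugate_dist_mul conjugate_of_real
    using re_of_real_mult[of "r\<^sup>2" "a * conjugate a"] by (simp add: power2_eq_square ac_simps)
  thus "norm2 (T x) = (\<Sum>u\<in>U. (\<mu> u)\<^sup>2 * abs2 (ip x u))"
    unfolding Tx norm2_sum_orthonormal[OF assms(1)] by simp
qed

lemma norm2_span: "orthonormal U \<Longrightarrow> x \<in> span U \<Longrightarrow> norm2 x = (\<Sum>u\<in>U. abs2 (ip x u))"
  by (rule onb_norm2) (simp_all add: onb_def)

lemma norm2_unit: "orthonormal U \<Longrightarrow> u \<in> U \<Longrightarrow> norm2 u = 1"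
  by (simp add: norm2_def orthonormal_def re_1)

text \<open>One half of the Courant-Fischer principle: orthogonality to the \<open>i\<close> leading
  eigenvectors removes every coordinate whose eigenvalue could exceed the one at index
  \<open>i\<close>, counted from 0.\<close>

lemma eigenbasis_form_le:
  assumes E: "eigenbasis X T us \<mu>" and T: "lin T" and i: "i < length us"
    and w: "w \<in> X" "\<And>z. z \<in> set (take i us) \<Longrightarrow> ip w z = 0"
  shows "re (ip (T w) w) \<le> \<mu> (us ! i) * norm2 w"
proof -
  note E' = eigenbasisD[OF E]
  have le: "\<mu> u * abs2 (ip w u) \<le> \<mu> (us ! i) * abs2 (ip w u)" if u: "u \<in> set us" for u
  proof -
    obtain l where l: "l < length us" "u = us ! l" using u by (auto simp: in_set_conv_nth)
    show ?thesis
    proof (cases "l < i")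
      case True
      hence "u \<in> set (take i us)" using l i by (auto simp: in_set_conv_nth)
      thus ?thesis using w by simp
    next
      case False
      thus ?thesis using l E'(6)[of i l] by (intro mult_right_mono) auto
    qed
  qed
  have ws: "w \<in> span (set us)" using w E' by simp
  have form: "re (ip (T w) w) = (\<Sum>u\<in>set us. \<mu> u * abs2 (ip w u))"
    by (rule eigen_form(1)[OF E'(3) ws T E'(5)])
  show ?thesis
    unfolding form norm2_span[OF E'(3) ws] sum_distrib_left
    by (rule sum_mono) (rule le)
qed

text \<open>The other half: on this span all eigenvalues are at least the one at index
  \<open>i\<close>. Its dimension \<open>Suc i\<close> exceeds by one the \<open>i\<close>
  conditions of \<open>eigenbasis_form_le\<close>, so for two eigenbases a nonzero vector subject to
  both halves exists.\<close>

lemma eigenbasis_head: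
  assumes E: "eigenbasis X T us \<mu>" and i: "i < length us"
  shows "orthonormal (set (take (Suc i) us))" "dim (span (set (take (Suc i) us))) = Suc i"
    "\<And>u. u \<in> set (take (Suc i) us) \<Longrightarrow> \<mu> (us ! i) \<le> \<mu> u"
    "\<And>u. u \<in> set (take (Suc i) us) \<Longrightarrow> T u = of_real (\<mu> u) *s u"
    "span (set (take (Suc i) us)) \<subseteq> X"
proof -
  note E' = eigenbasisD[OF E]
  show o: "orthonormal (set (take (Suc i) us))"
    by (rule orthonormal_subset[OF E'(3)]) (rule set_take_subset)
  show "dim (span (set (take (Suc i) us))) = Suc i"
    unfolding dim_span_orthonormal[OF o] using i E'(1) by (simp add: distinct_card)
  show "\<mu> (us ! i) \<le> \<mu> u" if "u \<in> set (take (Suc i) us)" for u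
    using that i E'(6)[of _ i] by (auto simp: in_set_conv_nth)
  show "T u = of_real (\<mu> u) *s u" if "u \<in> set (take (Suc i) us)" for u
    using that E'(5) by (meson in_set_takeD)
  show "span (set (take (Suc i) us)) \<subseteq> X"
    using span_mono[OF set_take_subset[of "Suc i" us]] E'(4) by simp
qed

lemma dim_le_dim_UNIV: "dim X \<le> dim (UNIV :: 'v set)"
  by (intro dim_subset) simp

lemma lin_orth_projector: "subspace X \<Longrightarrow> lin (orth_projector X)"
  by (rule symmetric_lin[OF orth_projector_symmetric])

lemma lin_compression: "subspace X \<Longrightarrow> symmetric A \<Longrightarrow> lin (orth_projector X \<circ> A)"
  using lin_orth_projector[of X] symmetric_lin[of A] by simp

lemma ip_compression:
  "subspace X \<Longrightarrow> x \<in> X \<Longrightarrow> ip ((orth_projector X \<circ> A) y) x = ip (A y) x"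
  by (simp add: ip_orth_projector_left)

text \<open>On an eigenbasis of \<open>A\<close> the eigenvalues are values of the nonnegative form
  at unit vectors; \<open>B\<close> acts there by their square roots.\<close>

lemma exists_sqrt:
  assumes A: "symmetric A" "\<And>x. re (ip (A x) x) \<ge> 0"
  obtains B where "symmetric B" "\<And>x. B (B x) = A x"
proof -
  obtain us \<mu> where E: "eigenbasis UNIV A us \<mu>"
    using exists_eigenbasis[of UNIV A] A symmetric_lin[OF A(1)] by (metis UNIV_I subspace_UNIV)
  note E' = eigenbasisD[OF E]
  define B where "B x = (\<Sum>u\<in>set us. (of_real (sqrt (\<mu> u)) * ip x u) *s u)" for x
  have \<mu>: "\<mu> u \<ge> 0" if "u \<in> set us" for u
    using A(2)[of u] E'(5)[OF that] norm2_unit[OF E'(3) that]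
    by (simp add: ip_scale_left re_of_real_mult norm2_def)
  have ipB: "ip (B x) y = (\<Sum>u\<in>set us. of_real (sqrt (\<mu> u)) * (ip x u * ip u y))" for x y
    by (simp add: B_def ip_sum_left ip_scale_left mult.assoc)
  have "symmetric B"
  proof (intro allI)
    fix x y
    have "ip x (B y) = conjugate (ip (B y) x)" by (rule ip_conjugate)
    also have "\<dots> = (\<Sum>u\<in>set us. of_real (sqrt (\<mu> u)) * (ip x u * ip u y))"
      unfolding ipB
      by (simp add: sum_conjugate conjugate_dist_mul conjugate_of_real flip: ip_conjugate)
        (simp add: mult.commute)
    finally show "ip (B x) y = ip x (B y)" by (simp add: ipB)
  qed
  moreover have "B (B x) = A x" for x
  proof -
    have "B (B x) = (\<Sum>u\<in>set us. (of_real (\<mu> u) * ip x u) *s u)"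
      unfolding B_def[of "B x"]
    proof (intro sum.cong refl arg_cong2[where f = "(*s)"])
      fix u assume u: "u \<in> set us"
      have "ip (B x) u = of_real (sqrt (\<mu> u)) * ip x u"
        unfolding B_def by (rule ip_sum_orthonormal[OF E'(3) u])
      moreover have "(of_real (sqrt (\<mu> u)) :: 'k) * of_real (sqrt (\<mu> u)) = of_real (\<mu> u)"
        using \<mu>[OF u] by (simp flip: of_real_mult)
      ultimately show "of_real (sqrt (\<mu> u)) * ip (B x) u = of_real (\<mu> u) * ip x u"
        by (simp flip: mult.assoc)
    qed
    also have "\<dots> = A (\<Sum>u\<in>set us. ip x u *s u)"
      using eigen_expand[OF symmetric_lin[OF A(1)] E'(5)] by metis
    also have "\<dots> = A x" using onb_expand[OF E'(2), of x] by simp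
    finally show ?thesis .
  qed
  ultimately show ?thesis by (rule that)
qed

subsection \<open>Perturbation of Ritz values\<close>

text \<open>Weyl monotonicity, tested on \<open>B x\<close> for a suitable \<open>x\<close> in the
  span of the leading Ritz vectors. Dimension counting makes \<open>B x\<close> orthogonal to the
  first \<open>i\<close> vectors of \<open>hs\<close>. Then \<open>\<alpha> (vs ! i)\<close> times
  \<open>norm2 (B x)\<close> is at most \<open>norm2 (?P (A x))\<close>, which the hypothesis on
  \<open>C\<close> bounds by the form of \<open>B C B\<close> at \<open>B x\<close> plus
  \<open>\<tau> * norm2 (A x)\<close>. The form is controlled by \<open>\<gamma> (hs ! i)\<close>,
  and \<open>norm2 (A x)\<close> is at most \<open>c * norm2 (B x)\<close>.\<close>

lemma ritz_value_le:
  assumes A: "symmetric A" and B: "symmetric B" "\<And>x. B (B x) = A x"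
    and c: "c \<ge> 0" "\<And>x. re (ip (A x) x) \<le> c * norm2 x"
    and Y: "subspace Y" "eigenbasis Y (orth_projector Y \<circ> A) vs \<alpha>"
    and C: "symmetric C" "\<And>z. re (ip (C z) z) \<ge> 0"
    and \<tau>: "\<tau> \<ge> 0" "\<And>z. norm2 (orth_projector Y z) \<le> re (ip (C z) z) + \<tau> * norm2 z"
    and hs: "eigenbasis UNIV (\<lambda>x. B (C (B x))) hs \<gamma>"
    and i: "i < length vs"
  shows "\<alpha> (vs ! i) \<le> \<gamma> (hs ! i) + c * \<tau>"
proof (rule ccontr)
  assume contra: "\<not> ?thesis"
  let ?P = "orth_projector Y" and ?M = "\<lambda>x. B (C (B x))"
  note hs' = eigenbasisD[OF hs] and head = eigenbasis_head[OF Y(2) i]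
  have ih: "i < length hs"
    using i eigenbasis_length[OF Y(2)] eigenbasis_length[OF hs] dim_le_dim_UNIV[of Y] by simp
  have M: "symmetric ?M" using B(1) C(1) by simp
  have ipM: "ip (?M x) x = ip (C (B x)) (B x)" for x using B(1) by simp
  have "re (ip (?M (hs ! i)) (hs ! i)) = \<gamma> (hs ! i)"
    using hs'(5)[of "hs ! i"] ih norm2_unit[OF hs'(3), of "hs ! i"]
    by (simp add: ip_scale_left re_of_real_mult norm2_def)
  hence \<gamma>: "\<gamma> (hs ! i) \<ge> 0" using C(2)[of "B (hs ! i)"] ipM[of "hs ! i"] by simp
  \<comment> \<open>The contrary assumption makes this Ritz value positive. That gives
    \<open>B x\<close> a positive norm, by which the final inequality is divided, and makes all
    \<open>\<alpha> u\<close> with \<open>u\<close> in \<open>?U\<close> positive.\<close>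
  have a: "\<alpha> (vs ! i) > 0" using contra \<gamma> mult_nonneg_nonneg[OF c(1) \<tau>(1)] by linarith
  let ?U = "set (take (Suc i) vs)"
  obtain x where x: "x \<in> span ?U" "x \<noteq> 0" "\<And>z. z \<in> set (take i hs) \<Longrightarrow> ip x (B z) = 0"
    using exists_orthogonal_vector[of "span ?U" "map B (take i hs)"] head(2) ih
    by (auto simp del: dim_span)
  have xY: "x \<in> Y" using x head by auto
  note form = eigen_form[OF head(1) x(1) lin_compression[OF Y(1) A] head(4)]
  have nB: "norm2 (B z) = re (ip (A z) z)" for z
    using B(1) B(2)[of z] unfolding norm2_def by metis
  have f1: "norm2 (B x) = (\<Sum>u\<in>?U. \<alpha> u * abs2 (ip x u))"
    using form(1) ip_compression[OF Y(1) xY, of A x] nB[of x] by simp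
  have "\<alpha> (vs ! i) * norm2 x \<le> norm2 (B x)"
    unfolding f1 norm2_span[OF head(1) x(1)] sum_distrib_left
    by (intro sum_mono mult_right_mono head(3)) auto
  moreover have "\<alpha> (vs ! i) * norm2 x > 0" using a x(2) norm2_pos by simp
  ultimately have pos: "norm2 (B x) > 0" by linarith
  have form2: "norm2 (?P (A x)) = (\<Sum>u\<in>?U. (\<alpha> u)\<^sup>2 * abs2 (ip x u))"
    using form(2) by simp
  have "\<alpha> (vs ! i) * norm2 (B x) \<le> norm2 (?P (A x))"
    unfolding f1 sum_distrib_left form2
  proof (rule sum_mono)
    fix u assume u: "u \<in> ?U"
    have "\<alpha> (vs ! i) * (\<alpha> u * abs2 (ip x u)) \<le> \<alpha> u * (\<alpha> u * abs2 (ip x u))"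
      using head(3)[OF u] a by (intro mult_right_mono) auto
    thus "\<alpha> (vs ! i) * (\<alpha> u * abs2 (ip x u)) \<le> (\<alpha> u)\<^sup>2 * abs2 (ip x u)"
      by (simp add: power2_eq_square mult.assoc)
  qed
  also have "\<dots> \<le> re (ip (C (A x)) (A x)) + \<tau> * norm2 (A x)" by (rule \<tau>(2))
  also have "re (ip (C (A x)) (A x)) = re (ip (?M (B x)) (B x))"
    using ipM[of "B x"] B(2)[of x] by simp
  also have "\<dots> \<le> \<gamma> (hs ! i) * norm2 (B x)"
    using B(1) x(3) by (intro eigenbasis_form_le[OF hs symmetric_lin[OF M] ih]) auto
  finally have "\<alpha> (vs ! i) * norm2 (B x) \<le> \<gamma> (hs ! i) * norm2 (B x) + \<tau> * norm2 (A x)"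
    by simp
  moreover have "norm2 (A x) \<le> c * norm2 (B x)"
    using nB[of "B x"] B(2)[of x] c(2)[of "B x"] by simp
  ultimately have "\<alpha> (vs ! i) * norm2 (B x) \<le> (\<gamma> (hs ! i) + c * \<tau>) * norm2 (B x)"
    using mult_left_mono[OF _ \<tau>(1), of "norm2 (A x)" "c * norm2 (B x)"]
    by (simp add: algebra_simps)
  thus False using pos contra by simp
qed

lemma ritz_values_gain:
  assumes A: "symmetric A" "\<And>x. re (ip (A x) x) \<ge> 0"
    and c: "c \<ge> 0" "\<And>x. re (ip (A x) x) \<le> c * norm2 x"
    and X: "subspace X" "eigenbasis X (orth_projector X \<circ> A) us \<beta>"
    and Y: "subspace Y" "eigenbasis Y (orth_projector Y \<circ> A) vs \<alpha>"
    and dim: "dim X = dim Y"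
    and gs: "eigenbasis UNIV (\<lambda>z. orth_projector Y z - orth_projector X z) gs \<delta>"
    and \<tau>: "\<tau> \<ge> 0"
    and J: "J \<subseteq> {..<dim X}"
  shows "(\<Sum>i\<in>J. \<alpha> (vs ! i) - \<beta> (us ! i))
    \<le> c * \<tau> * card J + (\<Sum>g\<in>set gs. max 0 (\<delta> g - \<tau>) * re (ip (A g) g))"
proof -
  let ?PX = "orth_projector X" and ?PY = "orth_projector Y"
  obtain B where B: "symmetric B" "\<And>x. B (B x) = A x" using exists_sqrt[OF A] by blast
  note gs' = eigenbasisD[OF gs] and us' = eigenbasisD[OF X(2)]
  have nB: "norm2 (B z) = re (ip (A z) z)" for z
    using B(1) B(2)[of z] unfolding norm2_def by metis
  define e where "e g = max 0 (\<delta> g - \<tau>)" for g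
  \<comment> \<open>\<open>E\<close> is the positive part of P_Y - P_X - \<open>\<tau>\<close>: it
    is nonnegative, and P_Y - P_X is at most \<open>E\<close> plus \<open>\<tau>\<close>. Both
    properties enter the comparison with \<open>C\<close>.\<close>
  define E where "E z = (\<Sum>g\<in>set gs. (of_real (e g) * ip z g) *s g)" for z
  define C where "C z = ?PX z + E z" for z
  have ipE: "ip (E x) y = (\<Sum>g\<in>set gs. of_real (e g) * (ip x g * ip g y))" for x y
    by (simp add: E_def ip_sum_left ip_scale_left mult.assoc)
  have E: "symmetric E"
  proof (intro allI)
    fix x y
    have "ip x (E y) = conjugate (ip (E y) x)" by (rule ip_conjugate)
    also have "\<dots> = (\<Sum>u\<in>set gs. of_real (e u) * (ip x u * ip u y))"
      unfolding ipE
      by (simp add: sum_conjugate conjugate_dist_mul conjugate_of_real flip: ip_conjugate)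
        (simp add: mult.commute)
    finally show "ip (E x) y = ip x (E y)" by (simp add: ipE)
  qed
  have C: "symmetric C"
    using E orth_projector_symmetric[OF X(1)] by (simp add: C_def ip_add_left ip_add_right)
  have formE: "re (ip (E z) z) = (\<Sum>g\<in>set gs. e g * abs2 (ip z g))" for z
    unfolding ipE re_sum re_of_real_mult abs2_def by (metis ip_conjugate)
  have formC: "re (ip (C z) z) = norm2 (?PX z) + (\<Sum>g\<in>set gs. e g * abs2 (ip z g))" for z
    by (simp add: C_def ip_add_left re_add formE re_ip_orth_projector[OF X(1)])
  have E0: "(\<Sum>g\<in>set gs. e g * abs2 (ip z g)) \<ge> 0" for z
    by (intro sum_nonneg mult_nonneg_nonneg) (auto simp: e_def)
  have C0: "re (ip (C z) z) \<ge> 0" for z unfolding formC using E0[of z] by simp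
  have linD: "lin (\<lambda>z. ?PY z - ?PX z)"
    using lin_orth_projector[OF X(1)] lin_orth_projector[OF Y(1)]
    by (simp add: scale_right_diff_distrib)
  have CY: "norm2 (?PY z) \<le> re (ip (C z) z) + \<tau> * norm2 z" for z
  proof -
    have z: "z \<in> span (set gs)" using gs'(4) by simp
    have "norm2 (?PY z) - norm2 (?PX z) = re (ip (?PY z - ?PX z) z)"
      by (simp add: ip_diff_left re_diff re_ip_orth_projector X(1) Y(1))
    also have "\<dots> = (\<Sum>g\<in>set gs. \<delta> g * abs2 (ip z g))"
      by (rule eigen_form(1)[OF gs'(3) z linD gs'(5)])
    also have "\<dots> \<le> (\<Sum>g\<in>set gs. e g * abs2 (ip z g) + \<tau> * abs2 (ip z g))"
      unfolding distrib_right[symmetric] by (intro sum_mono mult_right_mono) (auto simp: e_def)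
    also have "\<dots> = (\<Sum>g\<in>set gs. e g * abs2 (ip z g)) + \<tau> * norm2 z"
      by (simp add: sum.distrib norm2_span[OF gs'(3) z] sum_distrib_left)
    finally show ?thesis unfolding formC by simp
  qed
  let ?M = "\<lambda>x. B (C (B x))"
  have M: "symmetric ?M" using B(1) C by simp
  obtain hs \<gamma> where hs: "eigenbasis UNIV ?M hs \<gamma>"
    using exists_eigenbasis[of UNIV ?M] M symmetric_lin[OF M] by (metis UNIV_I subspace_UNIV)
  note hs' = eigenbasisD[OF hs]
  have lens: "length us = dim X" "length vs = dim X" "dim X \<le> length hs"
    using eigenbasis_length[OF X(2)] eigenbasis_length[OF Y(2)] eigenbasis_length[OF hs]
      dim dim_le_dim_UNIV[of X] by auto
  have \<alpha>\<gamma>: "\<alpha> (vs ! i) \<le> \<gamma> (hs ! i) + c * \<tau>" if "i < dim X" for i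
    using that lens by (intro ritz_value_le[OF A(1) B c Y C C0 \<tau> CY hs]) auto
  have \<beta>\<gamma>: "\<beta> (us ! i) \<le> \<gamma> (hs ! i)" if "i < dim X" for i
  proof -
    \<comment> \<open>The same comparison, now with \<open>X\<close> in place of \<open>Y\<close>
      and 0 in place of \<open>\<tau>\<close>; it rests on \<open>E\<close> being
      nonnegative.\<close>
    have "norm2 (?PX z) \<le> re (ip (C z) z) + 0 * norm2 z" for z
      unfolding formC using E0[of z] by simp
    from ritz_value_le[OF A(1) B c X C C0 order_refl this hs, of i] that lens show ?thesis by simp
  qed
  have \<gamma>: "\<gamma> h = re (ip (C (B h)) (B h))" if "h \<in> set hs" for h
  proof -
    have "re (ip (?M h) h) = \<gamma> h"
      unfolding hs'(5)[OF that] using norm2_unit[OF hs'(3) that]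
      by (simp add: ip_scale_left re_of_real_mult norm2_def)
    thus ?thesis using B(1) by simp
  qed
  have \<gamma>0: "\<gamma> h \<ge> 0" if "h \<in> set hs" for h using \<gamma>[OF that] C0 by simp
  have trace: "(\<Sum>h\<in>set hs. abs2 (ip (B h) z)) = re (ip (A z) z)" for z
  proof -
    have "(\<Sum>h\<in>set hs. abs2 (ip (B h) z)) = (\<Sum>h\<in>set hs. abs2 (ip (B z) h))"
      by (intro sum.cong refl) (metis B(1) abs2_ip_commute)
    also have "\<dots> = norm2 (B z)" using norm2_span[OF hs'(3), of "B z"] hs'(4) by simp
    finally show ?thesis by (simp add: nB)
  qed
  have \<beta>: "re (ip (A u) u) = \<beta> u" if "u \<in> set us" for u
  proof -
    have "u \<in> X" using that us'(4) span_base by blast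
    hence "ip (A u) u = ip ((?PX \<circ> A) u) u" by (simp add: ip_orth_projector_left[OF X(1)])
    thus ?thesis unfolding us'(5)[OF that] using norm2_unit[OF us'(3) that]
      by (simp add: ip_scale_left re_of_real_mult norm2_def)
  qed
  \<comment> \<open>The sum of the eigenvalues is the trace of \<open>?M\<close>. Exchanging the
    sums and applying Parseval over \<open>hs\<close> turns it into the sum of the Ritz values on
    \<open>X\<close> plus the trace of \<open>A E\<close>.\<close>
  have "(\<Sum>h\<in>set hs. \<gamma> h) = (\<Sum>h\<in>set hs. \<Sum>u\<in>set us. abs2 (ip (B h) u))
      + (\<Sum>h\<in>set hs. \<Sum>g\<in>set gs. e g * abs2 (ip (B h) g))"
    by (simp add: \<gamma> formC orth_projector_eq[OF us'(2)] norm2_sum_orthonormal[OF us'(3)] sum.distrib)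
  also have "\<dots> = (\<Sum>u\<in>set us. re (ip (A u) u)) + (\<Sum>g\<in>set gs. e g * re (ip (A g) g))"
    by (subst (1 2) sum.swap) (simp only: sum_distrib_left[symmetric] trace)
  also have "(\<Sum>u\<in>set us. re (ip (A u) u)) = (\<Sum>u\<in>set us. \<beta> u)" by (simp add: \<beta>)
  finally have tr: "(\<Sum>h\<in>set hs. \<gamma> h) = (\<Sum>u\<in>set us. \<beta> u) + (\<Sum>g\<in>set gs. e g * re (ip (A g) g))" .
  have idx: "(\<Sum>x\<in>set xs. f x) = (\<Sum>i<length xs. f (xs ! i))" if "distinct xs" for f :: "'v \<Rightarrow> real" and xs
    using that by (simp add: sum_list_distinct_conv_sum_set[symmetric] sum_list_sum_nth atLeast0LessThan)
  have "(\<Sum>i\<in>J. \<alpha> (vs ! i) - \<beta> (us ! i)) \<le> (\<Sum>i\<in>J. c * \<tau> + (\<gamma> (hs ! i) - \<beta> (us ! i)))"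
    using J \<alpha>\<gamma> by (intro sum_mono) (auto simp: algebra_simps)
  also have "\<dots> = c * \<tau> * card J + (\<Sum>i\<in>J. \<gamma> (hs ! i) - \<beta> (us ! i))"
    by (simp add: sum.distrib)
  \<comment> \<open>Two enlargements by nonnegative terms lead to full traces: first to the indices
    outside \<open>J\<close>, then to the eigenvalues of \<open>?M\<close> beyond the first
    \<open>dim X\<close>.\<close>
  also have "(\<Sum>i\<in>J. \<gamma> (hs ! i) - \<beta> (us ! i)) \<le> (\<Sum>i<dim X. \<gamma> (hs ! i) - \<beta> (us ! i))"
    using J \<beta>\<gamma> by (intro sum_mono2) auto
  also have "\<dots> = (\<Sum>i<dim X. \<gamma> (hs ! i)) - (\<Sum>u\<in>set us. \<beta> u)"
    by (simp add: sum_subtractf idx[OF us'(1)] lens)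
  also have "(\<Sum>i<dim X. \<gamma> (hs ! i)) \<le> (\<Sum>i<length hs. \<gamma> (hs ! i))"
    using lens \<gamma>0 by (intro sum_mono2) auto
  also have "\<dots> = (\<Sum>h\<in>set hs. \<gamma> h)" by (simp add: idx[OF hs'(1)])
  finally show ?thesis unfolding tr e_def by simp
qed

text \<open>The one-sided bound is used twice with the same difference P_Y - P_X: for
  \<open>A\<close> - \<open>lo\<close> at the indices where the Ritz value on \<open>Y\<close> is at
  least the one on \<open>X\<close>, and for \<open>hi\<close> - \<open>A\<close> at the others.
  Keeping the same \<open>gs\<close> lets the two trace terms be added vector by vector.\<close>

lemma ritz_values_distance:
  fixes lo hi \<tau> :: real and \<alpha> \<beta> \<delta> :: "'v \<Rightarrow> real"
  assumes A: "symmetric A" "\<And>x. lo * norm2 x \<le> re (ip (A x) x)" "\<And>x. re (ip (A x) x) \<le> hi * norm2 x"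
    and lohi: "lo \<le> hi"
    and X: "subspace X" "eigenbasis X (orth_projector X \<circ> A) us \<beta>"
    and Y: "subspace Y" "eigenbasis Y (orth_projector Y \<circ> A) vs \<alpha>"
    and dim: "dim X = dim Y"
    and gs: "eigenbasis UNIV (\<lambda>z. orth_projector Y z - orth_projector X z) gs \<delta>"
    and \<tau>: "\<tau> \<ge> 0"
    and J: "J \<subseteq> {..<dim X}"
  shows "(\<Sum>i\<in>J. \<bar>\<alpha> (vs ! i) - \<beta> (us ! i)\<bar>)
    \<le> (hi - lo) * (\<tau> * card J + (\<Sum>g\<in>set gs. max 0 (\<delta> g - \<tau>)))"
proof -
  note gs' = eigenbasisD[OF gs]
  define A1 where "A1 x = A x - of_real lo *s x" for x
  define A2 where "A2 x = of_real hi *s x - A x" for x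
  have form1: "re (ip (A1 x) x) = re (ip (A x) x) - lo * norm2 x" for x
    by (simp add: A1_def ip_diff_left ip_scale_left re_diff re_of_real_mult norm2_def)
  have form2: "re (ip (A2 x) x) = hi * norm2 x - re (ip (A x) x)" for x
    by (simp add: A2_def ip_diff_left ip_scale_left re_diff re_of_real_mult norm2_def)
  have A1: "symmetric A1" "\<And>x. re (ip (A1 x) x) \<ge> 0" "\<And>x. re (ip (A1 x) x) \<le> (hi - lo) * norm2 x"
    using A unfolding form1
    by (auto simp: A1_def ip_diff_left ip_scale_left ip_diff_right ip_scale_right
        conjugate_of_real algebra_simps)
  have A2: "symmetric A2" "\<And>x. re (ip (A2 x) x) \<ge> 0" "\<And>x. re (ip (A2 x) x) \<le> (hi - lo) * norm2 x"
    using A unfolding form2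
    by (auto simp: A2_def ip_diff_left ip_scale_left ip_diff_right ip_scale_right
        conjugate_of_real algebra_simps)
  have E1: "eigenbasis Z (orth_projector Z \<circ> A1) ws (\<lambda>u. \<mu> u - lo)"
    if Z: "subspace Z" and E: "eigenbasis Z (orth_projector Z \<circ> A) ws \<mu>" for Z ws and \<mu> :: "'v \<Rightarrow> real"
  proof -
    have "(orth_projector Z \<circ> A1) u = of_real (\<mu> u - lo) *s u" if u: "u \<in> set ws" for u
    proof -
      have "u \<in> Z" using u eigenbasisD(4)[OF E] span_base by blast
      thus ?thesis
        using eigenbasisD(5)[OF E u] lin_orth_projector[OF Z] symmetric_diff[OF orth_projector_symmetric[OF Z]]
        by (simp add: A1_def orth_projector_id[OF Z] scale_left_diff_distrib)
    qed
    thus ?thesis using E unfolding eigenbasis_def by (auto simp: sorted_wrt_iff_nth_less)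
  qed
  \<comment> \<open>Subtracting from \<open>hi\<close> reverses the order of the eigenvalues, hence
    \<open>rev ws\<close>; index \<open>i\<close> turns into \<open>?r i\<close> below.\<close>
  have E2: "eigenbasis Z (orth_projector Z \<circ> A2) (rev ws) (\<lambda>u. hi - \<mu> u)"
    if Z: "subspace Z" and E: "eigenbasis Z (orth_projector Z \<circ> A) ws \<mu>" for Z ws and \<mu> :: "'v \<Rightarrow> real"
  proof -
    have "(orth_projector Z \<circ> A2) u = of_real (hi - \<mu> u) *s u" if u: "u \<in> set ws" for u
    proof -
      have "u \<in> Z" using u eigenbasisD(4)[OF E] span_base by blast
      thus ?thesis
        using eigenbasisD(5)[OF E u] lin_orth_projector[OF Z] symmetric_diff[OF orth_projector_symmetric[OF Z]]
        by (simp add: A2_def orth_projector_id[OF Z] scale_left_diff_distrib)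
    qed
    moreover have "sorted_wrt (\<ge>) (map (\<lambda>u. hi - \<mu> u) (rev ws))"
      using E unfolding eigenbasis_def rev_map[symmetric] sorted_wrt_rev
      by (auto simp: sorted_wrt_iff_nth_less)
    ultimately show ?thesis using E unfolding eigenbasis_def by auto
  qed
  define J1 where "J1 = {i\<in>J. \<alpha> (vs ! i) \<ge> \<beta> (us ! i)}"
  define J2 where "J2 = {i\<in>J. \<not> \<alpha> (vs ! i) \<ge> \<beta> (us ! i)}"
  let ?m = "dim X"
  let ?r = "\<lambda>i. ?m - Suc i"
  have fin: "finite J" using J finite_subset by blast
  have lens: "length us = ?m" "length vs = ?m"
    using eigenbasis_length[OF X(2)] eigenbasis_length[OF Y(2)] dim by auto
  have J2m: "i < ?m" if "i \<in> J2" for i using that J by (auto simp: J2_def)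
  have inj: "inj_on ?r J2"
  proof (rule inj_onI)
    fix x y assume "x \<in> J2" "y \<in> J2" "?r x = ?r y"
    thus "x = y" using J2m[of x] J2m[of y] by simp
  qed
  have hl: "hi - lo \<ge> 0" using lohi by simp
  have J1J: "J1 \<subseteq> {..<?m}" using J by (auto simp: J1_def)
  from ritz_values_gain[OF A1(1,2) hl A1(3) X(1) E1[OF X] Y(1) E1[OF Y] dim gs \<tau> J1J]
  have 1: "(\<Sum>i\<in>J1. \<alpha> (vs ! i) - \<beta> (us ! i))
    \<le> (hi - lo) * \<tau> * card J1 + (\<Sum>g\<in>set gs. max 0 (\<delta> g - \<tau>) * re (ip (A1 g) g))"
    by simp
  have J2J: "?r ` J2 \<subseteq> {..<?m}" using J2m by fastforce
  from ritz_values_gain[OF A2(1,2) hl A2(3) X(1) E2[OF X] Y(1) E2[OF Y] dim gs \<tau> J2J]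
  have "(\<Sum>i\<in>?r ` J2. \<beta> (rev us ! i) - \<alpha> (rev vs ! i))
    \<le> (hi - lo) * \<tau> * card J2 + (\<Sum>g\<in>set gs. max 0 (\<delta> g - \<tau>) * re (ip (A2 g) g))"
    by (simp add: card_image[OF inj])
  also have "(\<Sum>i\<in>?r ` J2. \<beta> (rev us ! i) - \<alpha> (rev vs ! i)) = (\<Sum>i\<in>J2. \<beta> (us ! i) - \<alpha> (vs ! i))"
    unfolding sum.reindex[OF inj]
  proof (rule sum.cong)
    fix i assume "i \<in> J2"
    hence "?m - Suc (?m - Suc i) = i" "?m - Suc i < ?m" using J2m[of i] by auto
    thus "((\<lambda>i. \<beta> (rev us ! i) - \<alpha> (rev vs ! i)) \<circ> ?r) i = \<beta> (us ! i) - \<alpha> (vs ! i)"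
      using lens by (simp add: rev_nth)
  qed simp
  finally have 2: "(\<Sum>i\<in>J2. \<beta> (us ! i) - \<alpha> (vs ! i))
    \<le> (hi - lo) * \<tau> * card J2 + (\<Sum>g\<in>set gs. max 0 (\<delta> g - \<tau>) * re (ip (A2 g) g))" .
  have J12: "J = J1 \<union> J2" "J1 \<inter> J2 = {}" "finite J1" "finite J2"
    using fin by (auto simp: J1_def J2_def)
  have "(\<Sum>i\<in>J. \<bar>\<alpha> (vs ! i) - \<beta> (us ! i)\<bar>)
      = (\<Sum>i\<in>J1. \<bar>\<alpha> (vs ! i) - \<beta> (us ! i)\<bar>) + (\<Sum>i\<in>J2. \<bar>\<alpha> (vs ! i) - \<beta> (us ! i)\<bar>)"
    using J12 by (simp add: sum.union_disjoint)
  also have "(\<Sum>i\<in>J1. \<bar>\<alpha> (vs ! i) - \<beta> (us ! i)\<bar>) = (\<Sum>i\<in>J1. \<alpha> (vs ! i) - \<beta> (us ! i))"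
    by (intro sum.cong) (auto simp: J1_def)
  also have "(\<Sum>i\<in>J2. \<bar>\<alpha> (vs ! i) - \<beta> (us ! i)\<bar>) = (\<Sum>i\<in>J2. \<beta> (us ! i) - \<alpha> (vs ! i))"
    by (intro sum.cong) (auto simp: J2_def)
  also have "(\<Sum>i\<in>J1. \<alpha> (vs ! i) - \<beta> (us ! i)) + (\<Sum>i\<in>J2. \<beta> (us ! i) - \<alpha> (vs ! i))
     \<le> (hi - lo) * \<tau> * (real (card J1) + real (card J2))
      + (\<Sum>g\<in>set gs. max 0 (\<delta> g - \<tau>) * re (ip (A1 g) g) + max 0 (\<delta> g - \<tau>) * re (ip (A2 g) g))"
    using add_mono[OF 1 2] by (simp add: sum.distrib algebra_simps)
  also have "real (card J1) + real (card J2) = card J" using J12 by (simp add: card_Un_disjoint)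
  \<comment> \<open>At a unit vector \<open>g\<close> the forms of \<open>A1\<close> and
    \<open>A2\<close> add up to \<open>hi - lo\<close>, whatever the form of \<open>A\<close> is
    there.\<close>
  also have "(\<Sum>g\<in>set gs. max 0 (\<delta> g - \<tau>) * re (ip (A1 g) g) + max 0 (\<delta> g - \<tau>) * re (ip (A2 g) g))
     = (\<Sum>g\<in>set gs. (hi - lo) * max 0 (\<delta> g - \<tau>))"
    unfolding form1 form2 distrib_left[symmetric]
    by (intro sum.cong) (auto simp: norm2_unit[OF gs'(3)])
  finally show ?thesis by (simp add: sum_distrib_left algebra_simps)
qed

subsection \<open>Principal angles\<close>

lemma norm2_add: "norm2 (x + y) = norm2 x + 2 * re (ip x y) + norm2 y"
proof -
  have "re (ip y x) = re (ip x y)" by (metis ip_conjugate re_conjugate)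
  thus ?thesis by (simp add: norm2_def ip_add_left ip_add_right re_add)
qed

lemma re_ip_scale: "re (ip (of_real r *s x) y) = r * re (ip x y)"
  "re (ip x (of_real r *s y)) = r * re (ip x y)"
  by (simp_all add: ip_scale_left ip_scale_right conjugate_of_real re_of_real_mult)

lemma norm2_scale: "norm2 (of_real r *s x) = r\<^sup>2 * norm2 x"
  by (simp add: norm2_def re_ip_scale power2_eq_square)

lemma norm2_combination:
  "norm2 (of_real r *s x + of_real t *s y) = r\<^sup>2 * norm2 x + 2 * (r * t) * re (ip x y) + t\<^sup>2 * norm2 y"
  by (simp add: norm2_add norm2_scale re_ip_scale)

text \<open>This bounds the form of P_Y - P_X at one vector \<open>w\<close> by the sine of an
  angle. Split \<open>w\<close> into \<open>a\<close> in \<open>Y\<close> and \<open>c\<close>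
  orthogonal to \<open>Y\<close>. The claim is a combination of two squared norms being nonnegative,
  those of \<open>b - l p\<close> and \<open>s c + l q\<close>, with the hypothesis on
  \<open>p\<close>.\<close>

lemma projector_difference_le:
  assumes X: "subspace X" and Y: "subspace Y" and s: "0 \<le> s" "s \<le> 1"
    and le: "(1 - s\<^sup>2) * norm2 (orth_projector Y w) \<le> norm2 (orth_projector X (orth_projector Y w))"
  shows "norm2 (orth_projector Y w) - norm2 (orth_projector X w) \<le> s * norm2 w"
proof (cases "orth_projector Y w = 0")
  case True
  thus ?thesis using s norm2_nonneg[of "orth_projector X w"] norm2_nonneg[of w]
    by (smt (verit) mult_nonneg_nonneg norm2_0)
next
  case False
  define a c p where "a = orth_projector Y w" "c = w - a" "p = orth_projector X a"
  note defs = this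
  define b where "b = orth_projector X w"
  have na: "norm2 a > 0" using False norm2_pos defs by simp
  define r where "r = norm2 p / norm2 a"
  \<comment> \<open>\<open>q\<close> is the part of \<open>p\<close> orthogonal to \<open>a\<close>.
    Its squared norm is \<open>norm2 p\<close> times the squared sine of the angle between
    \<open>a\<close> and \<open>X\<close>, which is at most the square of \<open>s\<close>.\<close>
  define q where "q = p - of_real r *s a"
  define t where "t = re (ip c p)"
  \<comment> \<open>With this value, l^2 (1 + s) = l, so that the terms in \<open>norm2 p\<close>
    collected from the two squares collapse to \<open>l * norm2 p\<close>.\<close>
  define l where "l = 1 / (1 + s)"
  have nw: "norm2 w = norm2 a + norm2 c"
    using norm2_orth_projector_split[OF Y, of w] by (simp add: defs)
  have pa: "re (ip p a) = norm2 p" unfolding defs(3) by (rule re_ip_orth_projector[OF X])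
  have "q = of_real 1 *s p + of_real (- r) *s a" by (simp add: q_def)
  hence "norm2 q = norm2 p - 2 * r * norm2 p + r\<^sup>2 * norm2 a"
    by (simp only: norm2_combination pa) simp
  also have "\<dots> = norm2 p * (1 - r)" using na by (simp add: r_def field_simps power2_eq_square)
  also have "1 - r \<le> s\<^sup>2" using le na unfolding r_def defs[symmetric]
    by (simp add: field_simps del: norm2_eq_0_iff)
  finally have nq: "norm2 q \<le> norm2 p * s\<^sup>2" by (simp add: mult_left_mono)
  have "ip c a = 0"
    using ip_orth_projector_left[OF Y, of a w] Y by (simp add: defs ip_diff_left)
  hence cq: "re (ip c q) = t"
    by (simp add: q_def t_def ip_diff_right re_diff re_ip_scale)
  have ap: "re (ip a p) = norm2 p" by (metis pa ip_conjugate re_conjugate)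
  have "re (ip b p) = re (ip w p)"
    unfolding b_def using ip_orth_projector_left[OF X, of p w] X by (simp add: defs(3))
  also have "\<dots> = norm2 p + t"
    using ap by (simp add: t_def defs(2) ip_diff_left re_diff)
  finally have bp: "re (ip b p) = norm2 p + t" .
  have 1: "norm2 b - 2 * l * (norm2 p + t) + l\<^sup>2 * norm2 p \<ge> 0"
    using norm2_combination[of 1 b "- l" p] norm2_nonneg[of "of_real 1 *s b + of_real (- l) *s p"]
    unfolding bp by simp
  have 2: "- 2 * l * t \<le> s * norm2 c + l\<^sup>2 * norm2 p * s"
  \<comment> \<open>The second square has to be divided by \<open>s\<close>. For
    \<open>s = 0\<close> the vector \<open>q\<close> vanishes, and with it \<open>t\<close>.\<close>
  proof (cases "s = 0")
    case True
    hence "q = 0" using nq norm2_nonneg[of q] norm2_pos[of q] by fastforce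
    thus ?thesis using cq True by simp
  next
    case False
    hence s0: "s > 0" using s by simp
    have "0 \<le> s\<^sup>2 * norm2 c + 2 * (s * l) * t + l\<^sup>2 * norm2 q"
      using norm2_combination[of s c l q] norm2_nonneg[of "of_real s *s c + of_real l *s q"]
      unfolding cq by simp
    also have "l\<^sup>2 * norm2 q \<le> l\<^sup>2 * (norm2 p * s\<^sup>2)" by (intro mult_left_mono nq) simp
    finally have "0 \<le> s * (s * norm2 c + 2 * l * t + l\<^sup>2 * norm2 p * s)"
      by (simp add: algebra_simps power2_eq_square)
    hence "0 \<le> s * norm2 c + 2 * l * t + l\<^sup>2 * norm2 p * s"
      using s0 by (simp add: zero_le_mult_iff)
    thus ?thesis by simp
  qed
  have l1: "l * (1 + s) = 1" using s by (simp add: l_def)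
  hence "l\<^sup>2 * norm2 p * (1 + s) = l * norm2 p" by (metis power2_eq_square mult.assoc mult.commute mult_1)
  hence 3: "l\<^sup>2 * norm2 p + l\<^sup>2 * norm2 p * s = l * norm2 p" by (simp add: algebra_simps)
  have "l * ((1 - s\<^sup>2) * norm2 a) \<le> l * norm2 p"
    using le s unfolding defs[symmetric] by (intro mult_left_mono) (simp_all add: l_def)
  also have "l * ((1 - s\<^sup>2) * norm2 a) = (l * (1 + s)) * ((1 - s) * norm2 a)"
    by (simp add: algebra_simps power2_eq_square)
  finally have "(1 - s) * norm2 a \<le> l * norm2 p" unfolding l1 by simp
  hence "norm2 a - norm2 b \<le> s * norm2 a + s * norm2 c"
    using 1 2 3 by (simp add: algebra_simps)
  thus ?thesis unfolding nw b_def defs(1) by (simp add: algebra_simps)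
qed

text \<open>When the dimensions agree, \<open>\<kappa>\<close> gives the squared cosines of the
  principal angles. A vector \<open>w\<close> spanned by the leading eigenvectors of P_Y - P_X can
  be chosen so that its projection to \<open>Y\<close> avoids the smallest cosines; then
  \<open>projector_difference_le\<close> applies to \<open>w\<close>. Beyond \<open>dim Y\<close>,
  \<open>w\<close> can be chosen orthogonal to all of \<open>Y\<close>.\<close>

lemma projector_difference_eigenvalues_le:
  assumes X: "subspace X" and Y: "subspace Y"
    and ys: "eigenbasis Y (orth_projector Y \<circ> orth_projector X) ys \<kappa>"
    and gs: "eigenbasis UNIV (\<lambda>z. orth_projector Y z - orth_projector X z) gs \<delta>"
    and j: "j < length gs"
  shows "\<And>y. y \<in> set ys \<Longrightarrow> 0 \<le> \<kappa> y \<and> \<kappa> y \<le> 1"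
    and "j < dim Y \<Longrightarrow> \<delta> (gs ! j) \<le> sqrt (1 - \<kappa> (ys ! (dim Y - Suc j)))"
    and "dim Y \<le> j \<Longrightarrow> \<delta> (gs ! j) \<le> 0"
proof -
  let ?PX = "orth_projector X" and ?PY = "orth_projector Y" and ?m = "dim Y"
  note ys' = eigenbasisD[OF ys] and head = eigenbasis_head[OF gs j]
  have len: "length ys = ?m" by (rule eigenbasis_length[OF ys])
  have PXPY: "re (ip ((?PY \<circ> ?PX) a) a) = norm2 (?PX a)" if "a \<in> Y" for a
    using that by (simp add: ip_orth_projector_left Y re_ip_orth_projector X)
  show \<kappa>: "0 \<le> \<kappa> y \<and> \<kappa> y \<le> 1" if y: "y \<in> set ys" for y
  proof -
    have "y \<in> Y" using y ys'(4) span_base by blast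
    from PXPY[OF this] have "\<kappa> y = norm2 (?PX y)"
      unfolding ys'(5)[OF y] by (simp add: re_ip_scale norm2_unit[OF ys'(3) y] flip: norm2_def)
    thus ?thesis using norm2_orth_projector_le[OF X, of y] norm2_unit[OF ys'(3) y] by simp
  qed
  let ?S = "span (set (take (Suc j) gs))"
  have linD: "lin (\<lambda>z. ?PY z - ?PX z)"
    using lin_orth_projector[OF X] lin_orth_projector[OF Y]
    by (simp add: scale_right_diff_distrib)
  have lower: "\<delta> (gs ! j) * norm2 w \<le> norm2 (?PY w) - norm2 (?PX w)" if w: "w \<in> ?S" for w
  proof -
    have "norm2 (?PY w) - norm2 (?PX w) = re (ip (?PY w - ?PX w) w)"
      by (simp add: ip_diff_left re_diff re_ip_orth_projector X Y)
    also have "\<dots> = (\<Sum>u\<in>set (take (Suc j) gs). \<delta> u * abs2 (ip w u))"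
      by (rule eigen_form(1)[OF head(1) w linD head(4)])
    also have "\<dots> \<ge> (\<Sum>u\<in>set (take (Suc j) gs). \<delta> (gs ! j) * abs2 (ip w u))"
      by (intro sum_mono mult_right_mono head(3)) auto
    finally show ?thesis by (simp add: norm2_span[OF head(1) w] sum_distrib_left)
  qed
  have ipPY: "ip (?PY w) y = ip w y" if "y \<in> set ys" for w y
    using that ys'(4) span_base ip_orth_projector_left[OF Y, of y w] by blast
  have PYs: "?PY w \<in> span (set ys)" for w using ys'(4) Y by simp
  show "\<delta> (gs ! j) \<le> sqrt (1 - \<kappa> (ys ! (?m - Suc j)))" if jm: "j < ?m"
  proof -
    \<comment> \<open>The dropped list has \<open>j\<close> entries, one fewer than the dimension of
      \<open>?S\<close>. The smallest squared cosine left over is the one at index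
      \<open>?m - Suc j\<close>.\<close>
    obtain w where w: "w \<in> ?S" "w \<noteq> 0" "\<And>z. z \<in> set (drop (?m - j) ys) \<Longrightarrow> ip w z = 0"
      using exists_orthogonal_vector[of ?S "drop (?m - j) ys"] head(2) jm len
      by (auto simp del: dim_span)
    let ?k = "\<kappa> (ys ! (?m - Suc j))"
    define s where "s = sqrt (1 - ?k)"
    have k: "0 \<le> ?k" "?k \<le> 1" using \<kappa>[of "ys ! (?m - Suc j)"] jm len by auto
    have s: "0 \<le> s" "s \<le> 1" "1 - s\<^sup>2 = ?k" using k by (auto simp: s_def)
    have term_le: "?k * abs2 (ip (?PY w) y) \<le> \<kappa> y * abs2 (ip (?PY w) y)" if y: "y \<in> set ys" for y
    proof -
      obtain l where l: "l < ?m" "y = ys ! l" using y len by (auto simp: in_set_conv_nth)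
      show ?thesis
      proof (cases "l < ?m - j")
        case True
        thus ?thesis using l len ys'(6)[of l "?m - Suc j"] jm by (intro mult_right_mono) auto
      next
        case False
        hence "y = drop (?m - j) ys ! (l - (?m - j))" "l - (?m - j) < length (drop (?m - j) ys)"
          using l len by auto
        hence "y \<in> set (drop (?m - j) ys)" by (metis nth_mem)
        thus ?thesis using w(3) ipPY[OF y] by simp
      qed
    qed
    have "?k * norm2 (?PY w) \<le> (\<Sum>y\<in>set ys. \<kappa> y * abs2 (ip (?PY w) y))"
      unfolding norm2_span[OF ys'(3) PYs] sum_distrib_left by (rule sum_mono) (rule term_le)
    also have "\<dots> = re (ip ((?PY \<circ> ?PX) (?PY w)) (?PY w))"
      using eigen_form(1)[OF ys'(3) PYs lin_compression[OF Y orth_projector_symmetric[OF X]] ys'(5)]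
      by metis
    also have "\<dots> = norm2 (?PX (?PY w))" using PXPY Y by simp
    finally have "norm2 (?PY w) - norm2 (?PX w) \<le> s * norm2 w"
      using s by (intro projector_difference_le[OF X Y]) auto
    hence "\<delta> (gs ! j) * norm2 w \<le> s * norm2 w" using lower[OF w(1)] by simp
    thus ?thesis using norm2_pos[OF w(2)] by (simp add: s_def)
  qed
  show "\<delta> (gs ! j) \<le> 0" if jm: "?m \<le> j"
  proof -
    obtain w where w: "w \<in> ?S" "w \<noteq> 0" "\<And>z. z \<in> set ys \<Longrightarrow> ip w z = 0"
      using exists_orthogonal_vector[of ?S ys] head(2) jm len
      by (auto simp del: dim_span)
    have "norm2 (?PY w) = 0" unfolding norm2_span[OF ys'(3) PYs] using w(3) ipPY by simp
    hence "\<delta> (gs ! j) * norm2 w \<le> 0" using lower[OF w(1)] norm2_nonneg[of "?PX w"] by linarith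
    thus ?thesis using norm2_pos[OF w(2)] by (simp add: mult_le_0_iff)
  qed
qed

section \<open>Principal angles from the eigenvalues of P_Y P_X on Y\<close>

lemma adjoint_op_eq: "(\<And>x y. ip (B x) y = ip x (C y)) \<Longrightarrow> adjoint_op B = C"
  unfolding adjoint_op_def by (rule some_equality) (auto intro!: ext ip_ext_right)

text \<open>The squared singular values are the eigenvalues of P_Y P_X P_Y on the whole space. This
  operator agrees with P_Y P_X on \<open>Y\<close> and vanishes on the orthogonal complement, so its
  eigenvalues are the \<open>\<kappa>\<close> values followed by zeros. Nonnegativity of
  \<open>\<kappa>\<close> puts the zeros last, where \<open>take\<close> cuts them off.\<close>

lemma principal_angles_eq:
  assumes X: "subspace X" and Y: "subspace Y" and dim: "dim X = dim Y"
    and ys: "eigenbasis Y (orth_projector Y \<circ> orth_projector X) ys \<kappa>"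
    and \<kappa>: "\<And>y. y \<in> set ys \<Longrightarrow> 0 \<le> \<kappa> y"
  shows "principal_angles X Y = map (\<lambda>y. arccos (sqrt (\<kappa> y))) ys"
proof -
  let ?PX = "orth_projector X" and ?PY = "orth_projector Y"
  note ys' = eigenbasisD[OF ys]
  note sym = orth_projector_symmetric[OF X] orth_projector_symmetric[OF Y]
  define K where "K v = ?PY (?PX (?PY v))" for v
  have "adjoint_op (?PX \<circ> ?PY) = ?PY \<circ> ?PX"
    by (rule adjoint_op_eq) (simp add: sym)
  hence adj: "adjoint_op (?PX \<circ> ?PY) \<circ> (?PX \<circ> ?PY) = K"
    by (auto simp: K_def orth_projector_id[OF X] X)
  define Z where "Z = {v. \<forall>y\<in>Y. ip v y = 0}"
  have subZ: "subspace Z" by (auto simp: Z_def subspace_def ip_add_left ip_scale_left)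
  obtain W where W: "onb Z W" using exists_onb[OF subZ] by blast
  obtain ws where ws: "set ws = W" "distinct ws"
    using W finite_distinct_list[of W] by (auto simp: onb_def orthonormal_def)
  have WZ: "W \<subseteq> Z" using W span_superset by (auto simp: onb_def)
  have ysY: "set ys \<subseteq> Y" using ys'(4) span_superset by blast
  have YZ: "v = 0" if "v \<in> Y" "v \<in> Z" for v using that ip_eq_0_iff[of v] by (auto simp: Z_def)
  have orth: "ip y w = 0" "ip w y = 0" if "y \<in> Y" "w \<in> Z" for y w
    using that ip_eq_0_commute by (auto simp: Z_def)
  have n0: "0 \<notin> W" "0 \<notin> set ys"
    using norm2_unit[of W 0] norm2_unit[OF ys'(3), of 0] W by (auto simp: onb_def)
  have disj: "set ys \<inter> set ws = {}" using YZ n0 ws ysY WZ by blast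
  have ortho: "orthonormal (set (ys @ ws))"
    unfolding orthonormal_def
  proof (intro conjI ballI)
    have oW: "orthonormal (set ws)" using W ws by (simp add: onb_def)
    fix u w assume "u \<in> set (ys @ ws)" "w \<in> set (ys @ ws)"
    then consider "u \<in> set ys" "w \<in> set ys" | "u \<in> set ws" "w \<in> set ws"
      | "u \<in> set ys" "w \<in> set ws" | "u \<in> set ws" "w \<in> set ys" by auto
    thus "ip u w = (if u = w then 1 else 0)"
    proof cases
      case 3
      thus ?thesis using orth(1)[of u w] ysY WZ ws disj by auto
    next
      case 4
      thus ?thesis using orth(2)[of w u] ysY WZ ws disj by auto
    qed (use ys'(3) oW in \<open>simp_all add: orthonormal_def\<close>)
  qed simp
  have sp: "span (set (ys @ ws)) = UNIV"
  proof -
    have "v \<in> span (set (ys @ ws))" for v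
    proof -
      have "v - ?PY v \<in> Z" by (simp add: Z_def ip_diff_left ip_orth_projector_left[OF Y])
      hence "v - ?PY v \<in> span (set ws)" using W ws by (simp add: onb_def)
      moreover have "?PY v \<in> span (set ys)" using ys'(4) Y by simp
      ultimately have "?PY v + (v - ?PY v) \<in> span (set (ys @ ws))"
        by (intro span_add) (auto intro: subsetD[OF span_mono, rotated])
      thus ?thesis by simp
    qed
    thus ?thesis by blast
  qed
  \<comment> \<open>Vectors of \<open>ws\<close> are nonzero and orthogonal to \<open>Y\<close>,
    hence outside \<open>Y\<close>, so membership in \<open>Y\<close> tells the two halves of the
    basis apart.\<close>
  define \<mu> where "\<mu> v = (if v \<in> Y then \<kappa> v else 0)" for v
  have \<mu>: "\<mu> y = \<kappa> y" if "y \<in> set ys" for y using that ysY by (auto simp: \<mu>_def)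
  have \<mu>0: "\<mu> w = 0" if "w \<in> set ws" for w
    using that WZ ws n0 YZ by (auto simp: \<mu>_def)
  have "K u = of_real (\<mu> u) *s u" if "u \<in> set (ys @ ws)" for u
  proof (cases "u \<in> set ys")
    case True
    thus ?thesis using ys'(5)[OF True] ysY by (auto simp: K_def orth_projector_id[OF Y] \<mu>)
  next
    case False
    hence u: "u \<in> Z" "u \<in> set ws" using that WZ ws by auto
    have "ip (?PY u) (?PY u) = 0" using u orth Y by (simp add: ip_orth_projector_left[OF Y])
    hence "?PY u = 0" by simp
    thus ?thesis using \<mu>0[OF u(2)] lin_0[OF lin_orth_projector[OF X]] lin_0[OF lin_orth_projector[OF Y]]
      by (simp add: K_def)
  qed
  moreover have "sorted_wrt (\<ge>) (map \<mu> (ys @ ws))"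
  proof -
    have "map \<mu> (ys @ ws) = map \<kappa> ys @ replicate (length ws) 0"
      using \<mu> \<mu>0 by (simp add: map_replicate_const[symmetric] cong: map_cong)
    moreover have "sorted_wrt (\<ge>) (replicate n (0::real))" for n by (induction n) auto
    ultimately show ?thesis using ys \<kappa> by (auto simp only: sorted_wrt_append eigenbasis_def set_map set_replicate_conv_if split: if_splits)
  qed
  ultimately have "eigenbasis UNIV K (ys @ ws) \<mu>"
    using ortho sp disj ws ys'(1) by (simp add: eigenbasis_def onb_def)
  moreover have "symmetric K" using sym by (simp add: K_def)
  ultimately have "Lambda_on UNIV K = map \<mu> (ys @ ws)"
    using Lambda_on_eq(1) symmetric_lin by blast
  hence "take (dim Y) (singular_values (?PX \<circ> ?PY)) = map (\<lambda>y. sqrt (\<kappa> y)) ys"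
    using eigenbasis_length[OF ys] \<mu> by (simp add: singular_values_def adj)
  thus ?thesis by (simp add: principal_angles_def dim)
qed

section \<open>The majorization for real and complex scalars at once\<close>

theorem ritz_values_weakly_majorized:
  assumes A: "hermitian A" and X: "subspace X" and Y: "subspace Y" and dim: "dim X = dim Y"
  shows "abs_diff (ritz_values A X) (ritz_values A Y)
    \<prec>\<^sub>w map (\<lambda>\<theta>. (Max (eigenvalues_on UNIV A) - Min (eigenvalues_on UNIV A)) * sin \<theta>)
          (principal_angles X Y)"
proof -
  let ?PX = "orth_projector X" and ?PY = "orth_projector Y" and ?m = "dim Y"
  define hi lo where "hi = Max (eigenvalues_on UNIV A)" "lo = Min (eigenvalues_on UNIV A)"
  have symA: "symmetric A" using A by (rule hermitianD)
  note symX = orth_projector_symmetric[OF X] and symY = orth_projector_symmetric[OF Y]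
  have ritz: "\<exists>us \<mu>. eigenbasis Z (orth_projector Z \<circ> B) us \<mu>"
    if Z: "subspace Z" and B: "symmetric B" for Z B
  proof -
    obtain us \<mu> where "eigenbasis Z (orth_projector Z \<circ> B) us \<mu>"
      by (rule exists_eigenbasis[of Z "orth_projector Z \<circ> B"])
        (use Z B lin_compression[OF Z B] in \<open>simp_all add: ip_orth_projector_left ip_orth_projector_right\<close>)
    thus ?thesis by blast
  qed
  obtain us \<beta> where us: "eigenbasis X (?PX \<circ> A) us \<beta>" using ritz[OF X symA] by blast
  obtain vs \<alpha> where vs: "eigenbasis Y (?PY \<circ> A) vs \<alpha>" using ritz[OF Y symA] by blast
  obtain ys \<kappa> where ys: "eigenbasis Y (?PY \<circ> ?PX) ys \<kappa>" using ritz[OF Y symX] by blast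
  define D where "D z = ?PY z - ?PX z" for z
  have symD: "symmetric D" using symX symY by (simp add: D_def ip_diff_left ip_diff_right)
  obtain gs \<delta> where gs: "eigenbasis UNIV D gs \<delta>"
    using exists_eigenbasis[of UNIV D] symD symmetric_lin[OF symD] by (metis UNIV_I subspace_UNIV)
  obtain es \<nu> where es: "eigenbasis UNIV A es \<nu>"
    using exists_eigenbasis[of UNIV A] symA symmetric_lin[OF symA] by (metis UNIV_I subspace_UNIV)
  note es' = eigenbasisD[OF es] and ys' = eigenbasisD[OF ys] and gs' = eigenbasisD[OF gs]
  note gs2 = gs[unfolded D_def[abs_def]]
  have lens: "length us = ?m" "length vs = ?m" "length ys = ?m" "?m \<le> length gs" "?m \<le> length es"
    using eigenbasis_length[OF us] eigenbasis_length[OF vs] eigenbasis_length[OF ys]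
      eigenbasis_length[OF gs] eigenbasis_length[OF es] dim dim_le_dim_UNIV[of Y] by auto
  have ev: "eigenvalues_on UNIV A = \<nu> ` set es"
    by (rule Lambda_on_eq(2)[OF es symmetric_lin[OF symA]])
  have \<nu>: "lo \<le> \<nu> a \<and> \<nu> a \<le> hi" if "a \<in> set es" for a
    using that by (simp add: hi_lo_def ev)
  have form: "re (ip (A x) x) = (\<Sum>a\<in>set es. \<nu> a * abs2 (ip x a))" "norm2 x = (\<Sum>a\<in>set es. abs2 (ip x a))" for x
    using eigen_form(1)[OF es'(3) _ symmetric_lin[OF symA] es'(5)] norm2_span[OF es'(3)] es'(4) by auto
  have lower: "lo * norm2 x \<le> re (ip (A x) x)" and upper: "re (ip (A x) x) \<le> hi * norm2 x" for x
    unfolding form sum_distrib_left using \<nu> by (auto intro!: sum_mono mult_right_mono)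
  \<comment> \<open>The sines in nonincreasing order, counted from 0: \<open>ys\<close> has
    nonincreasing cosines, so the largest sine belongs to its last entry.\<close>
  define s where "s j = sqrt (1 - \<kappa> (ys ! (?m - Suc j)))" for j
  have \<kappa>: "0 \<le> \<kappa> y \<and> \<kappa> y \<le> 1" if "y \<in> set ys" for y
  proof -
    have "?m > 0" using that lens by (cases ys) auto
    hence "0 < length gs" using lens by linarith
    from projector_difference_eigenvalues_le(1)[OF X Y ys gs2 this that] show ?thesis .
  qed
  have s_le: "s j \<le> s i" if "i \<le> j" "j < ?m" for i j
    using ys'(6)[of "?m - Suc j" "?m - Suc i"] that lens by (simp add: s_def)
  have s0: "s j \<ge> 0" if "j < ?m" for j
    using \<kappa>[of "ys ! (?m - Suc j)"] that lens by (simp add: s_def)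
  have \<delta>_le: "\<delta> (gs ! j) \<le> (if j < ?m then s j else 0)" if "j < length gs" for j
    using projector_difference_eigenvalues_le(2,3)[OF X Y ys gs2 that] by (simp add: s_def)
  let ?zs = "map (\<lambda>y. (hi - lo) * sqrt (1 - \<kappa> y)) ys"
  have angles: "map (\<lambda>\<theta>. (hi - lo) * sin \<theta>) (principal_angles X Y) = ?zs"
  proof -
    have "sin (arccos (sqrt (\<kappa> y))) = sqrt (1 - \<kappa> y)" if "y \<in> set ys" for y
      using \<kappa>[OF that] by (subst sin_arccos) (auto intro: order_trans[of _ 0])
    thus ?thesis using \<kappa> by (simp add: principal_angles_eq[OF X Y dim ys])
  qed
  have lists: "ritz_values A X = map \<beta> us" "ritz_values A Y = map \<alpha> vs"
    unfolding ritz_values_def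
    by (auto intro!: Lambda_on_eq(1) us vs lin_compression X Y symA simp del: o_apply)
  have "abs_diff (map \<beta> us) (map \<alpha> vs) \<prec>\<^sub>w ?zs"
  \<comment> \<open>If \<open>?m = 0\<close>, both lists are empty. The whole space may then be
    trivial, with no eigenvalues from which \<open>lo \<le> hi\<close> could be derived.\<close>
  proof (cases "?m = 0")
    case True
    thus ?thesis using lens by (simp add: weakly_majorized_def abs_diff_def)
  next
    case False
    hence "es \<noteq> []" using lens by auto
    hence lohi: "lo \<le> hi" using \<nu>[of "hd es"] by simp
    show ?thesis
    proof (rule weakly_majorizedI)
      show "length (abs_diff (map \<beta> us) (map \<alpha> vs)) = ?m" "length ?zs = ?m"
        using lens by (simp_all add: abs_diff_def)
      show "sorted ?zs"
        using ys'(6) lohi by (auto simp: sorted_iff_nth_mono intro!: mult_left_mono)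
      fix J assume J: "J \<subseteq> {..<?m}" "J \<noteq> {}"
      define k where "k = card J"
      have fin: "finite J" using J(1) finite_subset by blast
      have k: "0 < k" "k \<le> ?m" using J fin card_mono[OF _ J(1)] by (auto simp: k_def card_gt_0_iff)
      \<comment> \<open>The threshold is the \<open>k\<close>-th largest sine. Then only the first
        \<open>k\<close> eigenvalues of \<open>D\<close> can exceed it, and adding
        \<open>\<tau> * k\<close> to the bounds \<open>s j - \<tau>\<close> on the excesses gives
        exactly the sum of the \<open>k\<close> largest sines.\<close>
      define \<tau> where "\<tau> = s (k - 1)"
      have \<tau>: "\<tau> \<ge> 0" using s0 k by (simp add: \<tau>_def)
      have "(\<Sum>i\<in>J. abs_diff (map \<beta> us) (map \<alpha> vs) ! i) = (\<Sum>i\<in>J. \<bar>\<alpha> (vs ! i) - \<beta> (us ! i)\<bar>)"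
        using J(1) lens by (intro sum.cong) (auto simp: abs_diff_def)
      also have "\<dots> \<le> (hi - lo) * (\<tau> * k + (\<Sum>g\<in>set gs. max 0 (\<delta> g - \<tau>)))"
        unfolding k_def using J(1) dim
        by (intro ritz_values_distance[OF symA lower upper lohi X us Y vs dim gs2 \<tau>]) simp
      also have "(\<Sum>g\<in>set gs. max 0 (\<delta> g - \<tau>)) = (\<Sum>j<length gs. max 0 (\<delta> (gs ! j) - \<tau>))"
        using gs'(1)
        by (simp add: sum_list_distinct_conv_sum_set[symmetric] sum_list_sum_nth atLeast0LessThan)
      also have "\<dots> \<le> (\<Sum>j<length gs. if j < k then s j - \<tau> else 0)"
      proof (rule sum_mono)
        fix j assume "j \<in> {..<length gs}"
        hence "\<delta> (gs ! j) \<le> (if j < ?m then s j else 0)" using \<delta>_le by simp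
        moreover have "s j \<ge> \<tau>" if "j < k" using that k s_le[of j "k - 1"] by (simp add: \<tau>_def)
        moreover have "s j \<le> \<tau>" if "\<not> j < k" "j < ?m"
          using that k s_le[of "k - 1" j] by (simp add: \<tau>_def)
        ultimately show "max 0 (\<delta> (gs ! j) - \<tau>) \<le> (if j < k then s j - \<tau> else 0)"
          using k \<tau> by (auto split: if_splits)
      qed
      also have "\<dots> = (\<Sum>j<k. s j - \<tau>)"
        using k lens by (intro sum.mono_neutral_cong_right) auto
      also have "\<tau> * k + (\<Sum>j<k. s j - \<tau>) = (\<Sum>j<k. s j)" by (simp add: sum_subtractf)
      finally have "(\<Sum>i\<in>J. abs_diff (map \<beta> us) (map \<alpha> vs) ! i) \<le> (hi - lo) * (\<Sum>j<k. s j)"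
        using lohi by (simp add: mult_left_mono)
      also have "\<dots> = (\<Sum>j<k. ?zs ! (?m - Suc j))"
        unfolding sum_distrib_left using k lens by (intro sum.cong) (auto simp: s_def)
      finally show "(\<Sum>i\<in>J. abs_diff (map \<beta> us) (map \<alpha> vs) ! i) \<le> (\<Sum>j<card J. ?zs ! (?m - Suc j))"
        by (simp add: k_def)
    qed
  qed
  thus ?thesis unfolding lists angles[unfolded hi_lo_def, symmetric] hi_lo_def
    using angles by (simp add: hi_lo_def)
qed

end

section \<open>The real and the complex instance\<close>

lemma rc_inner_product_space_real:
  assumes "finite_dim_inner_product_space (scale :: real \<Rightarrow> 'v::ab_group_add \<Rightarrow> 'v) ip"
  shows "rc_inner_product_space scale ip (\<lambda>x. x)"
proof (intro rc_inner_product_space.intro rc_inner_product_space_axioms.intro assms)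
  fix p :: "real poly" assume "degree p > 0"
  thus "(\<exists>c. [:- c, 1:] dvd p) \<or>
      (\<exists>a b. b \<noteq> 0 \<and> [:of_real (a\<^sup>2 + b\<^sup>2), of_real (- 2 * a), 1:] dvd p)"
    using real_poly_factor[of p] by simp
qed auto

text \<open>Over the complex numbers the first alternative of the factor axiom always holds, by the
  fundamental theorem of algebra.\<close>

lemma rc_inner_product_space_complex:
  assumes "finite_dim_inner_product_space (scale :: complex \<Rightarrow> 'v::ab_group_add \<Rightarrow> 'v) ip"
  shows "rc_inner_product_space scale ip Re"
proof (intro rc_inner_product_space.intro rc_inner_product_space_axioms.intro assms)
  fix p :: "complex poly" assume "degree p > 0"
  hence "\<not> constant (poly p)" by (simp add: constant_degree)
  then obtain z where "poly p z = 0" using fundamental_theorem_of_algebra by blast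
  thus "(\<exists>c. [:- c, 1:] dvd p) \<or>
      (\<exists>a b. b \<noteq> 0 \<and> [:complex_of_real (a\<^sup>2 + b\<^sup>2), complex_of_real (- 2 * a), 1:] dvd p)"
    by (auto simp: poly_eq_0_iff_dvd)
qed (auto simp: complex_eq_iff)

theorem theorem4p2:
  shows
    "(\<forall>(scale :: real \<Rightarrow> 'v::ab_group_add \<Rightarrow> 'v::ab_group_add) ip A X Y.
       finite_dim_inner_product_space scale ip \<and>
       finite_dim_inner_product_space.hermitian scale ip A \<and>
       module.subspace scale X \<and> module.subspace scale Y \<and>
       vector_space.dim scale X = vector_space.dim scale Y \<longrightarrow>
       abs_diff (finite_dim_inner_product_space.ritz_values scale ip A X)
                (finite_dim_inner_product_space.ritz_values scale ip A Y)
       \<prec>\<^sub>w map (\<lambda>\<theta>. (Max (finite_dim_inner_product_space.eigenvalues_on scale UNIV A)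
                     - Min (finite_dim_inner_product_space.eigenvalues_on scale UNIV A)) * sin \<theta>)
              (finite_dim_inner_product_space.principal_angles scale ip X Y))
   \<and>
     (\<forall>(scale :: complex \<Rightarrow> 'w::ab_group_add \<Rightarrow> 'w::ab_group_add) ip A X Y.
       finite_dim_inner_product_space scale ip \<and>
       finite_dim_inner_product_space.hermitian scale ip A \<and>
       module.subspace scale X \<and> module.subspace scale Y \<and>
       vector_space.dim scale X = vector_space.dim scale Y \<longrightarrow>
       abs_diff (finite_dim_inner_product_space.ritz_values scale ip A X)
                (finite_dim_inner_product_space.ritz_values scale ip A Y)
       \<prec>\<^sub>w map (\<lambda>\<theta>. (Max (finite_dim_inner_product_space.eigenvalues_on scale UNIV A)
                     - Min (finite_dim_inner_product_space.eigenvalues_on scale UNIV A)) * sin \<theta>)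
              (finite_dim_inner_product_space.principal_angles scale ip X Y))"
  by (intro conjI allI impI; elim conjE)
    (rule rc_inner_product_space.ritz_values_weakly_majorized[OF rc_inner_product_space_real]
      rc_inner_product_space.ritz_values_weakly_majorized[OF rc_inner_product_space_complex];
      assumption)+

end
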